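(* Let $(X,f)$ be a topological dynamical system with $h_{\mathrm{top}}(f)<+\infty$, let $\varphi,\psi\in C(X,\mathbb{R})$ with $\psi>0$, and let $\beta_0$ be a real number. The potential function $\varphi$ freezes at $\beta_0$ if and only if the following properties hold: (1) $P_\psi(\beta\varphi)=\beta\cdot\operatorname{Max}^\psi(\varphi)+h_\infty^\psi(\varphi)$ for every $\beta\ge\beta_0$; (2) there exists $\beta_1>\beta_0$ such that $P_\psi(\beta_1\varphi)$ has at least one equilibrium state.
   Context: A topological dynamical system (TDS) $(X,f)$ is a continuous map $f:X\to X$ on a compact metric space $(X,d)$; $h_{\mathrm{top}}(f)$ is its topological entropy. $C(X,\mathbb{R})$ is the space of continuous real functions on $X$; $S_n\varphi=\sum_{i=0}^{n-1}\varphi\circ f^i$; $\mathbb{N}$ denotes the positive integers; $\mathcal{M}(X,f)$ is the set of $f$-invariant Borel probability measures and $h_\mu(f)$ the measure-theoretic entropy. Let $d_n(x,y)=\max\{d(f^ix,f^iy):0\le i\le n-1\}$. For nonempty $Z\subset X$, a set $F_n\subset X$ is an $(n,\varepsilon)$-spanning set of $Z$ if for each $y\in Z$ there is $x\in F_n$ with $d_n(x,y)\le\varepsilon$. For $\psi>0$ and $T>0$ let $S_T=\{n\in\mathbb{N}:\exists x\in X,\ S_n\psi(x)\le T\text{ and }S_{n+1}\psi(x)>T\}$, and for $n\in S_T$ let $X_n=\{x\in X:S_n\psi(x)\le T\text{ and }S_{n+1}\psi(x)>T\}$. Put $$Q_{\psi,T}(f,\varphi,\varepsilon)=\inf\Big\{\sum_{n\in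 S_T}\sum_{x\in F_n}e^{S_n\varphi(x)}:F_n\text{ is an }(n,\varepsilon)\text{-spanning set of }X_n,\ n\in S_T\Big\}.$$ The $\psi$-induced topological pressure of $\varphi$ is $P_\psi(\varphi)=\lim_{\varepsilon\to0}\limsup_{T\to\infty}\frac1T\log Q_{\psi,T}(f,\varphi,\varepsilon)$. A measure $\mu\in\mathcal{M}(X,f)$ is an equilibrium state of $P_\psi(\varphi)$ if $P_\psi(\varphi)=\frac{h_\mu(f)+\int\varphi\,d\mu}{\int\psi\,d\mu}$. The function $\varphi$ freezes at $\beta_0$ if there exists an invariant measure $\mu\in\mathcal{M}(X,f)$ such that $\mu$ is an equilibrium state of $P_\psi(\beta\varphi)$ for all $\beta\ge\beta_0$. Put $\operatorname{Max}^\psi(\varphi)=\sup_{\mu\in\mathcal{M}(X,f)}\frac{\int\varphi\,d\mu}{\int\psi\,d\mu}$, $M_{\max}^\psi(\varphi)=\{\mu\in\mathcal{M}(X,f):\frac{\int\varphi\,d\mu}{\int\psi\,d\mu}=\operatorname{Max}^\psi(\varphi)\}$, and $h_\infty^\psi(\varphi)=\sup\{\frac{h_\mu(f)}{\int\psi\,d\mu}:\mu\in M_{\max}^\psi(\varphi)\}$. *)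

theory Defs
  imports "HOL-Probability.Probability"
begin

text \<open>
  The phase space is a whole type \<open>'a :: metric_space\<close>; its compactness is a hypothesis
  of the theorem. Pressures and entropies are extended reals.
\<close>

definition birkhoff_sum :: "('a \<Rightarrow> 'a) \<Rightarrow> ('a \<Rightarrow> real) \<Rightarrow> nat \<Rightarrow> 'a \<Rightarrow> real" where
  "birkhoff_sum f \<phi> n x = (\<Sum>i<n. \<phi> ((f ^^ i) x))"

text \<open>Only used for \<open>n \<ge> 1\<close>; the maximum is unspecified for \<open>n = 0\<close>.\<close>

definition bowen_dist :: "('a::metric_space \<Rightarrow> 'a) \<Rightarrow> nat \<Rightarrow> 'a \<Rightarrow> 'a \<Rightarrow> real" where
  "bowen_dist f n x y = (MAX i\<in>{..<n}. dist ((f ^^ i) x) ((f ^^ i) y))"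

definition spanning_set ::
  "('a::metric_space \<Rightarrow> 'a) \<Rightarrow> nat \<Rightarrow> real \<Rightarrow> 'a set \<Rightarrow> 'a set \<Rightarrow> bool" where
  "spanning_set f n \<epsilon> Z F \<longleftrightarrow> (\<forall>y\<in>Z. \<exists>x\<in>F. bowen_dist f n x y \<le> \<epsilon>)"

definition spanning_number :: "('a::metric_space \<Rightarrow> 'a) \<Rightarrow> nat \<Rightarrow> real \<Rightarrow> nat" where
  "spanning_number f n \<epsilon> = Inf {card F |F. finite F \<and> spanning_set f n \<epsilon> UNIV F}"

definition topological_entropy :: "('a::metric_space \<Rightarrow> 'a) \<Rightarrow> ereal" where
  "topological_entropy f =
     Lim (at_right 0) (\<lambda>\<epsilon>. limsup (\<lambda>n. ereal (ln (real (spanning_number f n \<epsilon>)) / real n)))"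

definition invariant_measures :: "('a::topological_space \<Rightarrow> 'a) \<Rightarrow> 'a measure set" where
  "invariant_measures f =
     {\<mu>. prob_space \<mu> \<and> sets \<mu> = sets borel \<and> distr \<mu> borel f = \<mu>}"

text \<open>The convention \<open>0 * ln 0 = 0\<close> holds automatically.\<close>

definition partition_entropy :: "'a measure \<Rightarrow> 'a set set \<Rightarrow> real" where
  "partition_entropy \<mu> \<xi> = - (\<Sum>A\<in>\<xi>. measure \<mu> A * ln (measure \<mu> A))"

text \<open>The join \<open>\<Or>i<n. f\<^sup>-\<^sup>i \<xi>\<close>; \<open>common_refinement\<close> drops empty intersections.\<close>

definition dynamical_join :: "('a \<Rightarrow> 'a) \<Rightarrow> nat \<Rightarrow> 'a set set \<Rightarrow> 'a set set" where
  "dynamical_join f n \<xi> = common_refinement ((\<lambda>i. (\<lambda>A. (f ^^ i) -` A) ` \<xi>) ` {..<n})"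

definition entropy_wrt_partition :: "('a \<Rightarrow> 'a) \<Rightarrow> 'a measure \<Rightarrow> 'a set set \<Rightarrow> ereal" where
  "entropy_wrt_partition f \<mu> \<xi> =
     lim (\<lambda>n. ereal (partition_entropy \<mu> (dynamical_join f n \<xi>) / real n))"

definition measure_entropy :: "('a \<Rightarrow> 'a) \<Rightarrow> 'a measure \<Rightarrow> ereal" where
  "measure_entropy f \<mu> =
     (SUP \<xi>\<in>{\<xi>. finite \<xi> \<and> \<xi> \<subseteq> sets \<mu> \<and> partition_on (space \<mu>) \<xi>}. entropy_wrt_partition f \<mu> \<xi>)"

definition level_set :: "('a \<Rightarrow> 'a) \<Rightarrow> ('a \<Rightarrow> real) \<Rightarrow> real \<Rightarrow> nat \<Rightarrow> 'a set" where
  "level_set f \<psi> T n = {x. birkhoff_sum f \<psi> n x \<le> T \<and> birkhoff_sum f \<psi> (n + 1) x > T}"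

definition level_times :: "('a \<Rightarrow> 'a) \<Rightarrow> ('a \<Rightarrow> real) \<Rightarrow> real \<Rightarrow> nat set" where
  "level_times f \<psi> T =
     {n. n \<ge> 1 \<and> (\<exists>x. birkhoff_sum f \<psi> n x \<le> T \<and> birkhoff_sum f \<psi> (n + 1) x > T)}"

text \<open>The sums are taken in \<open>ennreal\<close>, so that an infinite spanning set contributes its true
  (possibly infinite) sum.\<close>

definition induced_Q ::
  "('a::metric_space \<Rightarrow> 'a) \<Rightarrow> ('a \<Rightarrow> real) \<Rightarrow> ('a \<Rightarrow> real) \<Rightarrow> real \<Rightarrow> real \<Rightarrow> ennreal" where
  "induced_Q f \<psi> \<phi> T \<epsilon> =
     (INF F\<in>{F :: nat \<Rightarrow> 'a set. \<forall>n\<in>level_times f \<psi> T. spanning_set f n \<epsilon> (level_set f \<psi> T n) (F n)}.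
        \<Sum>\<^sub>\<infinity>n\<in>level_times f \<psi> T. \<Sum>\<^sub>\<infinity>x\<in>F n. ennreal (exp (birkhoff_sum f \<phi> n x)))"

definition ln_ennreal :: "ennreal \<Rightarrow> ereal" where
  "ln_ennreal q =
     (if q = 0 then - \<infinity> else if q = \<infinity> then \<infinity> else ereal (ln (enn2real q)))"

definition induced_pressure ::
  "('a::metric_space \<Rightarrow> 'a) \<Rightarrow> ('a \<Rightarrow> real) \<Rightarrow> ('a \<Rightarrow> real) \<Rightarrow> ereal" where
  "induced_pressure f \<psi> \<phi> =
     Lim (at_right 0) (\<lambda>\<epsilon>. Limsup at_top (\<lambda>T. ereal (1 / T) * ln_ennreal (induced_Q f \<psi> \<phi> T \<epsilon>)))"

definition equilibrium_state ::
  "('a::metric_space \<Rightarrow> 'a) \<Rightarrow> ('a \<Rightarrow> real) \<Rightarrow> ('a \<Rightarrow> real) \<Rightarrow> 'a measure \<Rightarrow> bool" where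
  "equilibrium_state f \<psi> \<phi> \<mu> \<longleftrightarrow>
     \<mu> \<in> invariant_measures f \<and>
     induced_pressure f \<psi> \<phi> =
       (measure_entropy f \<mu> + ereal (\<integral>x. \<phi> x \<partial>\<mu>)) / ereal (\<integral>x. \<psi> x \<partial>\<mu>)"

definition freezes_at ::
  "('a::metric_space \<Rightarrow> 'a) \<Rightarrow> ('a \<Rightarrow> real) \<Rightarrow> ('a \<Rightarrow> real) \<Rightarrow> real \<Rightarrow> bool" where
  "freezes_at f \<psi> \<phi> \<beta>\<^sub>0 \<longleftrightarrow>
     (\<exists>\<mu>\<in>invariant_measures f. \<forall>\<beta>\<ge>\<beta>\<^sub>0. equilibrium_state f \<psi> (\<lambda>x. \<beta> * \<phi> x) \<mu>)"

text \<open>For continuous \<open>f\<close>, \<open>\<phi>\<close>, \<open>\<psi> > 0\<close> on a compact space the supremum is over a nonempty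
  bounded set of reals.\<close>

definition Max_ratio :: "('a::metric_space \<Rightarrow> 'a) \<Rightarrow> ('a \<Rightarrow> real) \<Rightarrow> ('a \<Rightarrow> real) \<Rightarrow> real" where
  "Max_ratio f \<psi> \<phi> = (SUP \<mu>\<in>invariant_measures f. (\<integral>x. \<phi> x \<partial>\<mu>) / (\<integral>x. \<psi> x \<partial>\<mu>))"

definition maximizing_measures ::
  "('a::metric_space \<Rightarrow> 'a) \<Rightarrow> ('a \<Rightarrow> real) \<Rightarrow> ('a \<Rightarrow> real) \<Rightarrow> 'a measure set" where
  "maximizing_measures f \<psi> \<phi> =
     {\<mu>\<in>invariant_measures f. (\<integral>x. \<phi> x \<partial>\<mu>) / (\<integral>x. \<psi> x \<partial>\<mu>) = Max_ratio f \<psi> \<phi>}"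

definition h_infinity :: "('a::metric_space \<Rightarrow> 'a) \<Rightarrow> ('a \<Rightarrow> real) \<Rightarrow> ('a \<Rightarrow> real) \<Rightarrow> ereal" where
  "h_infinity f \<psi> \<phi> =
     (SUP \<mu>\<in>maximizing_measures f \<psi> \<phi>. measure_entropy f \<mu> / ereal (\<integral>x. \<psi> x \<partial>\<mu>))"

end

theory Submission
  imports Defs
begin

text \<open>
  Write \<open>h \<nu>\<close> and \<open>a \<nu>\<close> for the entropy of an invariant measure \<open>\<nu>\<close> and for the integral of
  \<open>\<phi>\<close>, both divided by the integral of \<open>\<psi>\<close>.  Only one half of the variational principle is
  needed: \<open>h \<nu> + \<beta> * a \<nu> \<le> P\<^sub>\<psi>(\<beta>\<phi>)\<close> for every invariant \<open>\<nu>\<close> and every \<open>\<beta>\<close>.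

  If \<open>\<mu>\<close> is an equilibrium state for all \<open>\<beta> \<ge> \<beta>\<^sub>0\<close>, then \<open>h \<nu> + \<beta> * a \<nu> \<le> h \<mu> + \<beta> * a \<mu>\<close>
  for all such \<open>\<beta>\<close>.  Letting \<open>\<beta>\<close> tend to infinity shows that \<open>\<mu>\<close> maximizes \<open>a\<close> (here finiteness of
  the entropies enters, which is where the hypothesis on topological entropy is used), and comparing
  with the other maximizing measures gives \<open>h \<mu> = h\<^sub>\<infinity>\<close>.  Conversely, let \<open>\<mu>\<close> be an
  equilibrium state at \<open>\<beta>\<^sub>1 > \<beta>\<^sub>0\<close>.  The affine function \<open>\<beta> \<mapsto> h \<mu> + \<beta> * a \<mu>\<close> lies
  below the affine function of property (1) on \<open>[\<beta>\<^sub>0, \<infinity>)\<close>, has slope at most that of the latter, and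
  touches it at \<open>\<beta>\<^sub>1\<close>; comparing at \<open>\<beta>\<^sub>0\<close> shows that the slopes agree, so the two functions
  coincide.

  The inequality \<open>h \<nu> + a \<nu> \<le> P\<^sub>\<psi>(\<phi>)\<close> is a Misiurewicz-type argument.  Shrink the cells of a
  finite partition \<open>\<xi>\<close> to closed sets that carry almost all the measure.  Points that are close together
  and lie in the shrunken cells lie in the same cell, so the \<open>n\<close>-name of a point is determined by a
  spanning-set element that shadows it for time \<open>n\<close>, together with the \<open>n\<close>-name for the auxiliary
  partition \<open>Z\<close> into the discarded parts of the cells and one further piece; \<open>Z\<close> has small
  entropy (\<open>partition_coding_at_small_scale\<close>).  Subadditivity of entropy and the Gibbs
  inequality then bound the entropy of the \<open>n\<close>-names by the logarithm of a sum over any cover by sets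
  that are small in the Bowen metric (\<open>entropy_le_cover_sum\<close>).  Since the auxiliary entropy is
  itself arbitrarily small, no constant remains and no iterate of \<open>f\<close> has to be considered.

  To bring in the induced pressure at a fixed time \<open>n\<close>, let \<open>s > P\<^sub>\<psi>(\<phi>)\<close> and \<open>0 < m \<le> \<psi>\<close>.
  Every interval \<open>[S\<^sub>n\<psi>(x), S\<^sub>n\<^sub>+\<^sub>1\<psi>(x))\<close> contains a multiple of \<open>m\<close>, so the
  level sets at time \<open>n\<close> for the levels \<open>T = j * m\<close>, of which only linearly many in \<open>n\<close>
  matter, cover the space.  The spanning set for level \<open>T\<close> has total weight at most
  \<open>exp (s * T)\<close>, and \<open>T\<close> differs from \<open>S\<^sub>n\<psi>\<close> by a bounded amount on the level set, so the
  cover bound applied to \<open>S\<^sub>n\<phi> - s * S\<^sub>n\<psi>\<close> yields, after division by \<open>n\<close>, that the entropy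
  plus the integral of \<open>\<phi> - s * \<psi>\<close> is at most \<open>0\<close>
  (\<open>measure_entropy_le_of_induced_pressure_less\<close>).
\<close>

section \<open>Subadditive sequences and regularity of Borel measures\<close>

text \<open>Fekete's lemma for nonnegative sequences.\<close>

lemma fekete_subadditive_convergent:
  fixes u :: "nat \<Rightarrow> real"
  assumes nonneg: "\<And>n. 0 \<le> u n"
    and subadd: "\<And>m n. u (m + n) \<le> u m + u n"
  shows "convergent (\<lambda>n. u n / real n)"
proof -
  define L where "L = (INF n\<in>{1..}. u n / real n)"
  have bdd: "bdd_below ((\<lambda>n. u n / real n) ` {1..})"
    by (rule bdd_belowI2[where m = 0]) (auto simp: nonneg)
  have ge: "L \<le> u n / real n" if "n \<ge> 1" for n
    unfolding L_def using that by (intro cINF_lower[OF bdd]) auto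
  have mult: "u (q * k + r) \<le> real q * u k + u r" for q k r
  proof (induction q)
    case (Suc q)
    have "u (Suc q * k + r) \<le> u k + u (q * k + r)"
      using subadd[of k "q * k + r"] by (simp add: algebra_simps)
    with Suc show ?case by (simp add: algebra_simps)
  qed simp
  have "(\<lambda>n. u n / real n) \<longlonglongrightarrow> L"
  proof (rule LIMSEQ_I)
    fix e :: real assume e: "0 < e"
    have "\<exists>x\<in>(\<lambda>n. u n / real n) ` {1..}. x < L + e / 2"
      unfolding L_def by (rule cInf_lessD) (use e in auto)
    then obtain k where k: "k \<ge> 1" "u k / real k < L + e / 2" by auto
    \<comment> \<open>A bound for all remainder terms in the division of \<open>n\<close> by \<open>k\<close>.\<close>
    define M where "M = (\<Sum>r<k. u r)"
    have M: "u r \<le> M" if "r < k" for r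
      unfolding M_def using that by (intro member_le_sum) (auto simp: nonneg)
    obtain N :: nat where N: "2 * M / e < real N" using reals_Archimedean2 by blast
    show "\<exists>no. \<forall>n\<ge>no. norm (u n / real n - L) < e"
    proof (intro exI[of _ "max 1 N"] allI impI)
      fix n assume n: "max 1 N \<le> n"
      have "u n \<le> real (n div k) * u k + u (n mod k)"
        using mult[of "n div k" k "n mod k"] by simp
      also have "\<dots> \<le> real (n div k) * u k + M"
        using M[of "n mod k"] k by simp
      also have "real (n div k) * u k = real (n div k * k) * (u k / real k)"
        using k by simp
      also have "\<dots> \<le> real n * (u k / real k)"
        by (intro mult_right_mono) (simp_all add: nonneg del: of_nat_mult)
      finally have "u n / real n \<le> u k / real k + M / real n"
        using n by (simp add: field_simps)
      moreover have "M / real n < e / 2"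
      proof -
        have "2 * M / e < real n" using N n by linarith
        then show ?thesis using e n by (simp add: field_simps)
      qed
      ultimately have "u n / real n < L + e" using k by linarith
      moreover have "L \<le> u n / real n" using ge n by simp
      ultimately show "norm (u n / real n - L) < e" using e by simp
    qed
  qed
  then show ?thesis by (rule convergentI)
qed

lemma open_approx_closed:
  fixes \<mu> :: "'a::metric_space measure"
  assumes "finite_measure \<mu>" and sb: "sets \<mu> = sets borel" and "open S" and "e > 0"
  shows "\<exists>C. closed C \<and> C \<subseteq> S \<and> measure \<mu> (S - C) < e"
proof (cases "S = UNIV")
  case True
  then show ?thesis using assms by (intro exI[of _ S]) auto
next
  case False
  interpret finite_measure \<mu> by fact
  define C where "C n = {x. infdist x (- S) \<ge> 1 / real (Suc n)}" for n
  have closed: "closed (C n)" for n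
    unfolding C_def by (intro closed_Collect_le continuous_intros)
  have "C n \<subseteq> S" for n
  proof
    fix x assume "x \<in> C n"
    then have "infdist x (- S) > 0" unfolding C_def
      by (smt (verit) mem_Collect_eq of_nat_0_less_iff zero_less_Suc divide_pos_pos)
    then show "x \<in> S" using infdist_zero by force
  qed
  moreover have "\<exists>n. x \<in> C n" if "x \<in> S" for x
  proof -
    have "infdist x (- S) \<noteq> 0"
      using in_closed_iff_infdist_zero[of "- S" x] that assms False by (auto simp: closed_def)
    then have "infdist x (- S) > 0" using infdist_nonneg[of x "- S"] by linarith
    from reals_Archimedean[OF this] show ?thesis
      unfolding C_def by (auto simp: inverse_eq_divide intro: less_imp_le)
  qed
  ultimately have eq: "(\<Union>n. C n) = S" by blast
  have "incseq C"
  proof (rule incseq_SucI)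
    fix n
    have "1 / real (Suc (Suc n)) \<le> 1 / real (Suc n)" by (intro divide_left_mono) auto
    then show "C n \<subseteq> C (Suc n)" unfolding C_def by (auto intro: order_trans)
  qed
  moreover have "range C \<subseteq> sets \<mu>" using closed by (auto simp: sb)
  ultimately have "(\<lambda>n. measure \<mu> (C n)) \<longlonglongrightarrow> measure \<mu> (\<Union>n. C n)"
    by (intro finite_Lim_measure_incseq)
  then have "\<forall>\<^sub>F n in sequentially. measure \<mu> S - e < measure \<mu> (C n)"
    using \<open>e > 0\<close> eq by (intro order_tendstoD(1)) auto
  then obtain n where n: "measure \<mu> S - e < measure \<mu> (C n)"
    by (auto simp: eventually_sequentially)
  moreover have "measure \<mu> (S - C n) = measure \<mu> S - measure \<mu> (C n)"
    using closed \<open>C n \<subseteq> S\<close> \<open>open S\<close> by (intro finite_measure_Diff) (auto simp: sb)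
  ultimately show ?thesis using closed \<open>C n \<subseteq> S\<close> by (intro exI[of _ "C n"]) auto
qed

text \<open>
  Approximation by closed sets from inside and open sets from outside holds for finite Borel measures
  on every metric space, with no countability or completeness assumption on the type.
\<close>

lemma borel_regular_closed_open:
  fixes \<mu> :: "'a::metric_space measure"
  assumes "finite_measure \<mu>" and sb: "sets \<mu> = sets borel" and "A \<in> sets borel"
  shows "\<And>e. e > 0 \<Longrightarrow> \<exists>C U. closed C \<and> open U \<and> C \<subseteq> A \<and> A \<subseteq> U \<and> measure \<mu> (U - C) < e"
proof -
  interpret finite_measure \<mu> by fact
  have "A \<in> sigma_sets UNIV {S. open S}" using assms(3) by (simp add: borel_def)
  then show "\<And>e. e > 0 \<Longrightarrow> \<exists>C U. closed C \<and> open U \<and> C \<subseteq> A \<and> A \<subseteq> U \<and> measure \<mu> (U - C) < e"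
  proof (induction rule: sigma_sets.induct)
    case (Basic S)
    then show ?case using open_approx_closed[OF assms(1) sb, of S e] by blast
  next
    case Empty
    then show ?case by (intro exI[of _ "{}"]) auto
  next
    case (Compl A)
    obtain C U where CU: "closed C" "open U" "C \<subseteq> A" "A \<subseteq> U" "measure \<mu> (U - C) < e"
      using Compl.IH[OF Compl.prems] by auto
    have "- C - - U = U - C" by blast
    with CU have "closed (- U) \<and> open (- C) \<and> - U \<subseteq> UNIV - A \<and> UNIV - A \<subseteq> - C \<and>
        measure \<mu> (- C - - U) < e"
      by (auto simp only: open_Compl closed_Compl)
    then show ?case by blast
  next
    case (Union A)
    have "\<forall>i. \<exists>C U. closed C \<and> open U \<and> C \<subseteq> A i \<and> A i \<subseteq> U \<and> measure \<mu> (U - C) < e / 4 * (1/2) ^ i"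
      by (intro allI Union.IH) (use Union.prems in simp)
    then obtain C U where CU: "closed (C i)" "open (U i)" "C i \<subseteq> A i" "A i \<subseteq> U i"
      "measure \<mu> (U i - C i) < e / 4 * (1/2) ^ i" for i by metis
    define V D where "V = (\<Union>i. U i)" and "D n = (\<Union>i<n. C i)" for n
    have [measurable]: "C i \<in> sets \<mu>" "U i \<in> sets \<mu>" for i
      using CU by (auto simp: sb)
    have Dcl: "closed (D n)" for n unfolding D_def using CU by auto
    have geo: "(\<lambda>i. e / 4 * (1/2) ^ i) sums (e / 2)"
      using sums_mult[OF geometric_sums[of "1/2::real"], of "e / 4"] by simp
    have sm: "summable (\<lambda>i. measure \<mu> (U i - C i))"
      by (rule summable_comparison_test'[OF sums_summable[OF geo], of 0])
        (use less_imp_le[OF CU(5)] in simp)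
    have "measure \<mu> (V - (\<Union>i. C i)) \<le> measure \<mu> (\<Union>i. U i - C i)"
      unfolding V_def by (intro finite_measure_mono) auto
    also have "\<dots> \<le> (\<Sum>i. measure \<mu> (U i - C i))"
      by (intro finite_measure_subadditive_countably sm) auto
    also have "\<dots> \<le> (\<Sum>i. e / 4 * (1/2) ^ i)"
      by (intro suminf_le sm sums_summable[OF geo] less_imp_le[OF CU(5)])
    also have "\<dots> = e / 2" using geo by (rule sums_unique[symmetric])
    finally have 1: "measure \<mu> (V - (\<Union>i. C i)) \<le> e / 2" .
    have "(\<lambda>n. measure \<mu> (V - D n)) \<longlonglongrightarrow> measure \<mu> (\<Inter>n. V - D n)"
      by (intro finite_Lim_measure_decseq) (auto simp: D_def V_def decseq_def)
    moreover have "(\<Inter>n. V - D n) = V - (\<Union>i. C i)" by (auto simp: D_def)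
    ultimately have "(\<lambda>n. measure \<mu> (V - D n)) \<longlonglongrightarrow> measure \<mu> (V - (\<Union>i. C i))" by metis
    then have "\<forall>\<^sub>F n in sequentially. measure \<mu> (V - D n) < e"
      by (rule order_tendstoD(2)) (use 1 Union.prems in linarith)
    then obtain n where "measure \<mu> (V - D n) < e" by (auto simp: eventually_sequentially)
    moreover have "open V" unfolding V_def using CU(2) by auto
    moreover have "D n \<subseteq> (\<Union>i. A i)" "(\<Union>i. A i) \<subseteq> V"
      unfolding V_def D_def using CU(3,4) by blast+
    ultimately show ?case using Dcl by (intro exI[of _ "D n"] exI[of _ V] conjI)
  qed
qed

lemma closed_disjoint_separated:
  fixes A B :: "'a::metric_space set"
  assumes "compact (UNIV :: 'a set)" and "closed A" and "closed B" and "A \<inter> B = {}"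
  shows "\<exists>\<delta>>0. \<forall>x\<in>A. \<forall>y\<in>B. \<delta> \<le> dist x y"
proof (cases "A = {} \<or> B = {}")
  case True
  then show ?thesis by (auto intro: exI[of _ 1])
next
  case False
  have cA: "compact A" using compact_Int_closed[OF assms(1,2)] by simp
  have "continuous_on A (\<lambda>x. infdist x B)" by (intro continuous_intros)
  then obtain x where x: "x \<in> A" "\<forall>y\<in>A. infdist x B \<le> infdist y B"
    using continuous_attains_inf[OF cA, of "\<lambda>x. infdist x B"] False by auto
  have "infdist x B > 0"
    using in_closed_iff_infdist_zero[of B x] False assms x infdist_nonneg[of x B]
    by (smt (verit) disjoint_iff)
  with x show ?thesis by (meson infdist_le order_trans)
qed

lemma separated_closed_family:
  fixes B :: "'b \<Rightarrow> 'a::metric_space set"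
  assumes "compact (UNIV :: 'a set)" and "finite I"
    and "\<And>i. i \<in> I \<Longrightarrow> closed (B i)" and "\<And>i j. i \<in> I \<Longrightarrow> j \<in> I \<Longrightarrow> i \<noteq> j \<Longrightarrow> B i \<inter> B j = {}"
  shows "\<exists>r>0. \<forall>i\<in>I. \<forall>j\<in>I. \<forall>x\<in>B i. \<forall>y\<in>B j. dist x y < r \<longrightarrow> i = j"
proof -
  have "\<forall>i\<in>I. \<forall>j\<in>I. \<exists>\<delta>>0. i \<noteq> j \<longrightarrow> (\<forall>x\<in>B i. \<forall>y\<in>B j. \<delta> \<le> dist x y)"
    using closed_disjoint_separated[OF assms(1)] assms(3,4) by (metis zero_less_one)
  then obtain \<delta> where \<delta>: "\<And>i j. i \<in> I \<Longrightarrow> j \<in> I \<Longrightarrow> \<delta> i j > (0::real)"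
    "\<And>i j x y. i \<in> I \<Longrightarrow> j \<in> I \<Longrightarrow> i \<noteq> j \<Longrightarrow> x \<in> B i \<Longrightarrow> y \<in> B j \<Longrightarrow> \<delta> i j \<le> dist x y"
    by metis
  define r where "r = Min (insert 1 ((\<lambda>(i, j). \<delta> i j) ` (I \<times> I)))"
  have "r > 0" unfolding r_def using \<delta>(1) assms(2) by (subst Min_gr_iff) auto
  moreover have "r \<le> \<delta> i j" if "i \<in> I" "j \<in> I" for i j
    unfolding r_def using that assms(2) by (intro Min_le) auto
  moreover have "i = j" if "i \<in> I" "j \<in> I" "x \<in> B i" "y \<in> B j" "dist x y < r" for i j x y
    using calculation(2)[of i j] \<delta>(2)[of i j x y] that by force
  ultimately show ?thesis by blast
qed

section \<open>Entropy of finite-valued maps along an invariant measure\<close>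

text \<open>The entropy of the partition of the space into the level sets of a finite-valued map.\<close>

definition label_entropy :: "'a measure \<Rightarrow> ('a \<Rightarrow> 'b) \<Rightarrow> real" where
  "label_entropy \<mu> X = - (\<Sum>b\<in>range X. measure \<mu> (X -` {b}) * ln (measure \<mu> (X -` {b})))"

text \<open>
  An invariant Borel probability measure of a continuous map.  The base of the logarithm of the
  underlying information space is \<open>exp 1\<close>, so that its entropies use the natural logarithm.
\<close>

locale invariant_probability = information_space \<mu> "exp 1"
  for \<mu> :: "'a::metric_space measure" +
  fixes f :: "'a \<Rightarrow> 'a"
  assumes sets_eq: "sets \<mu> = sets borel"
    and continuous_f: "continuous_on UNIV f"
    and invariant: "distr \<mu> borel f = \<mu>"
begin

lemma space_eq: "space \<mu> = UNIV"
  using sets_eq_imp_space_eq[OF sets_eq] by simp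

lemma measurable_iterate: "f ^^ i \<in> measurable \<mu> \<mu>"
proof (induction i)
  case (Suc i)
  have "f \<in> measurable \<mu> \<mu>"
    using borel_measurable_continuous_onI[OF continuous_f]
    by (simp cong: measurable_cong_sets add: sets_eq)
  with Suc show ?case by (simp add: measurable_comp)
qed (simp add: id_def)

lemma distr_iterate: "distr \<mu> \<mu> (f ^^ i) = \<mu>"
proof (induction i)
  case (Suc i)
  have f: "f \<in> measurable \<mu> \<mu>" using measurable_iterate[of 1] by simp
  have "distr \<mu> \<mu> (f \<circ> f ^^ i) = distr (distr \<mu> \<mu> (f ^^ i)) \<mu> f"
    by (rule distr_distr[symmetric]) (use f measurable_iterate in auto)
  also have "\<dots> = distr \<mu> borel f" using Suc sets_eq by (auto intro: distr_cong)
  finally show ?case unfolding funpow.simps invariant .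
qed (simp add: id_def)

lemma prob_iterate:
  assumes "A \<in> sets \<mu>"
  shows "prob ((f ^^ i) -` A) = prob A"
  using measure_distr[OF measurable_iterate assms, of i] by (simp add: distr_iterate space_eq)

lemma finite_range_simple: "simple_function \<mu> X \<Longrightarrow> finite (range X)"
  using simple_functionD(1)[of \<mu> X] by (simp add: space_eq)

lemma vimage_simple: "simple_function \<mu> X \<Longrightarrow> X -` {b} \<in> sets \<mu>"
  using simple_functionD(2)[of \<mu> X "{b}"] by (simp add: space_eq)

lemma label_entropy_eq_entropy:
  assumes X: "simple_function \<mu> X"
  shows "label_entropy \<mu> X = entropy (exp 1) (count_space (X ` space \<mu>)) X"
  using entropy_simple_distributed[OF simple_distributedI[OF X measure_nonneg refl]]
  by (simp add: space_eq label_entropy_def log_ln[symmetric])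

text \<open>Labels that are not attained contribute nothing.\<close>

lemma entropy_eq_sum:
  assumes "finite R" and "range X \<subseteq> R"
  shows "label_entropy \<mu> X = - (\<Sum>b\<in>R. prob (X -` {b}) * ln (prob (X -` {b})))"
proof -
  have "(\<Sum>b\<in>range X. prob (X -` {b}) * ln (prob (X -` {b}))) =
      (\<Sum>b\<in>R. prob (X -` {b}) * ln (prob (X -` {b})))"
  proof (rule sum.mono_neutral_left[OF assms], rule ballI)
    fix b assume "b \<in> R - range X"
    then have "X -` {b} = {}" by auto
    then show "prob (X -` {b}) * ln (prob (X -` {b})) = 0" by (metis measure_empty mult_zero_left)
  qed
  then show ?thesis by (simp add: label_entropy_def)
qed

lemma entropy_nonneg: "0 \<le> label_entropy \<mu> X"
proof -
  have "prob A * ln (prob A) \<le> 0" for A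
    by (cases "prob A = 0") (auto intro!: mult_nonneg_nonpos simp: zero_less_measure_iff)
  then have "(\<Sum>b\<in>range X. prob (X -` {b}) * ln (prob (X -` {b}))) \<le> 0"
    by (intro sum_nonpos) auto
  then show ?thesis by (simp add: label_entropy_def)
qed

lemma entropy_subadditive:
  assumes X: "simple_function \<mu> X" and Y: "simple_function \<mu> Y"
  shows "label_entropy \<mu> (\<lambda>x. (X x, Y x)) \<le> label_entropy \<mu> X + label_entropy \<mu> Y"
  using entropy_chain_rule[OF X Y] conditional_entropy_less_eq_entropy[OF Y X]
  by (simp add: label_entropy_eq_entropy X Y simple_function_Pair)

text \<open>A map that is a function of \<open>X\<close> has at most the entropy of \<open>X\<close>.\<close>

lemma entropy_mono_determined:
  assumes X: "simple_function \<mu> X" and det: "\<And>x y. X x = X y \<Longrightarrow> Y x = Y y"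
  shows "label_entropy \<mu> Y \<le> label_entropy \<mu> X"
proof -
  have Y: "Y = (\<lambda>b. Y (inv X b)) \<circ> X"
    by (rule ext) (auto intro!: det simp: f_inv_into_f)
  have "simple_function \<mu> ((\<lambda>b. Y (inv X b)) \<circ> X)" by (rule simple_function_compose[OF X])
  then have "simple_function \<mu> Y" using Y by simp
  then show ?thesis using entropy_data_processing[OF X, of "\<lambda>b. Y (inv X b)"] Y
    by (simp add: label_entropy_eq_entropy X)
qed

lemma simple_iterate: "simple_function \<mu> X \<Longrightarrow> simple_function \<mu> (\<lambda>x. X ((f ^^ i) x))"
  by (rule simple_function_comp[OF measurable_iterate])

lemma entropy_iterate:
  assumes X: "simple_function \<mu> X"
  shows "label_entropy \<mu> (\<lambda>x. X ((f ^^ i) x)) = label_entropy \<mu> (X)"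
proof -
  have "prob ((\<lambda>x. X ((f ^^ i) x)) -` {b}) = prob (X -` {b})" for b
    using prob_iterate[OF vimage_simple[OF X], of i b] by (simp add: vimage_def)
  then show ?thesis
    using entropy_eq_sum[OF finite_range_simple[OF X], of X]
      entropy_eq_sum[OF finite_range_simple[OF X], of "\<lambda>x. X ((f ^^ i) x)"] by auto
qed

text \<open>
  The labels seen by the first \<open>n\<close> points of an orbit; its level sets are the atoms of the
  \<open>n\<close>-fold dynamical join of the partition defined by \<open>X\<close>.
\<close>

definition orbit_name :: "('a \<Rightarrow> 'b) \<Rightarrow> nat \<Rightarrow> 'a \<Rightarrow> 'b list" where
  "orbit_name X n x = map (\<lambda>i. X ((f ^^ i) x)) [0..<n]"

lemma orbit_name_eq_iff:
  "orbit_name X n x = orbit_name X n y \<longleftrightarrow> (\<forall>i<n. X ((f ^^ i) x) = X ((f ^^ i) y))"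
  by (auto simp: orbit_name_def)

lemma simple_orbit_name:
  assumes X: "simple_function \<mu> X"
  shows "simple_function \<mu> (orbit_name X n)"
proof (induction n)
  case (Suc n)
  have "orbit_name X (Suc n) = (\<lambda>x. orbit_name X n x @ [X ((f ^^ n) x)])"
    by (simp add: orbit_name_def fun_eq_iff)
  then show ?case
    using simple_function_compose2[OF Suc simple_iterate[OF X], of "\<lambda>a b. a @ [b]"] by simp
qed (simp add: orbit_name_def)

lemma entropy_orbit_name_add:
  assumes X: "simple_function \<mu> X"
  shows "label_entropy \<mu> (orbit_name X (m + n)) \<le> label_entropy \<mu> (orbit_name X m) + label_entropy \<mu> (orbit_name X n)"
proof -
  let ?Y = "\<lambda>x. (orbit_name X m x, orbit_name X n ((f ^^ m) x))"
  have Y: "simple_function \<mu> ?Y"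
    by (intro simple_function_Pair simple_orbit_name simple_iterate X)
  have "label_entropy \<mu> (orbit_name X (m + n)) \<le> label_entropy \<mu> (?Y)"
  proof (rule entropy_mono_determined[OF Y])
    fix x y assume *: "?Y x = ?Y y"
    have "X ((f ^^ i) x) = X ((f ^^ i) y)" if "i < m + n" for i
    proof (cases "i < m")
      case False
      then have i: "i - m < n" "i = (i - m) + m" using that by auto
      have "X ((f ^^ (i - m)) ((f ^^ m) x)) = X ((f ^^ (i - m)) ((f ^^ m) y))"
        using * i(1) by (auto simp: orbit_name_eq_iff)
      then show ?thesis by (subst (1 2) i(2)) (simp only: funpow_add o_apply)
    qed (use * in \<open>auto simp: orbit_name_eq_iff\<close>)
    then show "orbit_name X (m + n) x = orbit_name X (m + n) y" by (simp add: orbit_name_eq_iff)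
  qed
  also have "\<dots> \<le> label_entropy \<mu> (orbit_name X m) + label_entropy \<mu> (\<lambda>x. orbit_name X n ((f ^^ m) x))"
    by (intro entropy_subadditive simple_orbit_name simple_iterate X)
  finally show ?thesis by (simp add: entropy_iterate[OF simple_orbit_name[OF X]])
qed

lemma entropy_orbit_name_0: "label_entropy \<mu> (orbit_name X 0) = 0"
proof -
  have "range (orbit_name X 0) = {[]}" "orbit_name X 0 -` {[]} = space \<mu>"
    by (auto simp: orbit_name_def space_eq)
  then show ?thesis by (simp add: label_entropy_def prob_space)
qed

lemma entropy_orbit_name_le:
  assumes X: "simple_function \<mu> X"
  shows "label_entropy \<mu> (orbit_name X n) \<le> real n * label_entropy \<mu> (X)"
proof (induction n)
  case (Suc n)
  have "label_entropy \<mu> (orbit_name X 1) \<le> label_entropy \<mu> (X)"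
    by (rule entropy_mono_determined[OF X]) (simp add: orbit_name_eq_iff)
  then show ?case using Suc entropy_orbit_name_add[OF X, of n 1] by (simp add: algebra_simps)
qed (simp add: entropy_orbit_name_0)

lemma entropy_orbit_name_convergent:
  assumes X: "simple_function \<mu> X"
  shows "convergent (\<lambda>n. label_entropy \<mu> (orbit_name X n) / real n)"
  by (rule fekete_subadditive_convergent)
    (simp_all add: entropy_nonneg simple_orbit_name X entropy_orbit_name_add)

text \<open>
  The finite Gibbs inequality \<open>\<Sum> p\<^sub>l (a\<^sub>l - ln p\<^sub>l) \<le> ln (\<Sum> exp a\<^sub>l)\<close> for the distribution
  \<open>p\<close> of \<open>c\<close>, proved termwise from \<open>ln x \<le> x - 1\<close>.
\<close>

lemma gibbs_inequality:
  assumes c: "simple_function \<mu> c" and L: "finite L" "range c \<subseteq> L"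
  shows "label_entropy \<mu> (c) + (\<integral>x. a (c x) \<partial>\<mu>) \<le> ln (\<Sum>l\<in>L. exp (a l))"
proof -
  define p where "p l = prob (c -` {l})" for l
  define Z where "Z = (\<Sum>l\<in>L. exp (a l))"
  have "L \<noteq> {}" using L by auto
  then have Z: "Z > 0" unfolding Z_def using L by (intro sum_pos) auto
  have p: "p l \<ge> 0" for l by (simp add: p_def)
  have eq: "a (c x) = (\<Sum>l\<in>L. a l * indicator (c -` {l}) x)" for x
  proof -
    have "(\<Sum>l\<in>L. a l * indicator (c -` {l}) x) = (\<Sum>l\<in>L. if l = c x then a l else 0)"
      by (intro sum.cong) (auto simp: indicator_def)
    also have "\<dots> = a (c x)" using L by (subst sum.delta) auto
    finally show ?thesis ..
  qed
  have int: "integrable \<mu> (\<lambda>x. a l * indicator (c -` {l}) x)" for l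
    by (intro integrable_mult_right integrable_real_indicator vimage_simple c) (simp add: less_top[symmetric])
  have "(\<integral>x. a (c x) \<partial>\<mu>) = (\<Sum>l\<in>L. a l * p l)"
    unfolding eq p_def using int by (subst Bochner_Integration.integral_sum) (simp_all add: space_eq)
  moreover have "(\<Sum>l\<in>L. p l) = 1"
  proof -
    have "(\<Sum>l\<in>L. p l) = (\<integral>x. (\<Sum>l\<in>L. indicator (c -` {l}) x) \<partial>\<mu>)"
      unfolding p_def
      by (subst Bochner_Integration.integral_sum) 
        (auto simp: space_eq less_top[symmetric] intro!: integrable_real_indicator vimage_simple c)
    also have "(\<lambda>x. (\<Sum>l\<in>L. indicator (c -` {l}) x)) = (\<lambda>x. 1::real)"
    proof
      fix x
      have "(\<Sum>l\<in>L. indicator (c -` {l}) x) = (\<Sum>l\<in>L. if l = c x then 1 else (0::real))"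
        by (intro sum.cong) (auto simp: indicator_def)
      also have "\<dots> = 1" using L by (subst sum.delta) auto
      finally show "(\<Sum>l\<in>L. indicator (c -` {l}) x) = (1::real)" .
    qed
    finally show ?thesis by (simp add: prob_space)
  qed
  moreover have "p l * (a l - ln (p l) - ln Z) \<le> exp (a l) / Z - p l" for l
  proof (cases "p l = 0")
    case True
    then show ?thesis using Z by simp
  next
    case False
    then have pl: "p l > 0" using p[of l] by simp
    have "ln (exp (a l) / (p l * Z)) \<le> exp (a l) / (p l * Z) - 1"
      by (rule ln_le_minus_one) (use pl Z in auto)
    also have "ln (exp (a l) / (p l * Z)) = a l - ln (p l) - ln Z"
      using pl Z by (simp add: ln_div ln_mult)
    finally have "p l * (a l - ln (p l) - ln Z) \<le> p l * (exp (a l) / (p l * Z) - 1)"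
      by (rule mult_left_mono) (rule p)
    also have "\<dots> = exp (a l) / Z - p l" using pl Z by (simp add: field_simps)
    finally show ?thesis .
  qed
  then have "(\<Sum>l\<in>L. p l * (a l - ln (p l) - ln Z)) \<le> (\<Sum>l\<in>L. exp (a l) / Z - p l)"
    by (rule sum_mono)
  moreover have "(\<Sum>l\<in>L. exp (a l) / Z - p l) = 1 - (\<Sum>l\<in>L. p l)"
    using Z by (simp add: sum_subtractf sum_divide_distrib[symmetric] Z_def)
  moreover have "(\<Sum>l\<in>L. p l * (a l - ln (p l) - ln Z)) =
      (\<Sum>l\<in>L. a l * p l) - (\<Sum>l\<in>L. p l * ln (p l)) - (\<Sum>l\<in>L. p l) * ln Z"
    by (simp add: sum_subtractf sum_distrib_right right_diff_distrib mult.commute[of "a _"])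
  ultimately show ?thesis
    using entropy_eq_sum[OF L] by (simp add: p_def Z_def)
qed

end

section \<open>Partitions and their dynamical joins\<close>

text \<open>The element of the partition \<open>\<xi>\<close> that contains \<open>x\<close>.\<close>

definition cell :: "'a set set \<Rightarrow> 'a \<Rightarrow> 'a set" where
  "cell \<xi> x = (THE A. A \<in> \<xi> \<and> x \<in> A)"

lemma cell_eqI:
  assumes "partition_on UNIV \<xi>" and "A \<in> \<xi>" and "x \<in> A"
  shows "cell \<xi> x = A"
  unfolding cell_def
proof (rule the_equality)
  fix B assume "B \<in> \<xi> \<and> x \<in> B"
  then show "B = A" using assms partition_onD2[OF assms(1)] by (auto simp: disjoint_def)
qed (use assms in simp)

lemma cell_mem:
  assumes "partition_on UNIV \<xi>"
  shows "cell \<xi> x \<in> \<xi>" and "x \<in> cell \<xi> x"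
proof -
  obtain A where "A \<in> \<xi>" "x \<in> A" using partition_onD1[OF assms] by auto
  then show "cell \<xi> x \<in> \<xi>" "x \<in> cell \<xi> x" using cell_eqI[OF assms] by auto
qed

lemma dynamical_join_mem_eq:
  assumes part: "partition_on UNIV \<xi>" and "D \<in> dynamical_join f n \<xi>" and "x \<in> D"
  shows "D = {y. \<forall>i<n. cell \<xi> ((f ^^ i) y) = cell \<xi> ((f ^^ i) x)}"
proof -
  let ?P = "\<lambda>i. (\<lambda>A. (f ^^ i) -` A) ` \<xi>"
  obtain g where g: "\<And>i. i < n \<Longrightarrow> g (?P i) \<in> ?P i" and D: "D = (\<Inter>i<n. g (?P i))"
    using assms(2) unfolding dynamical_join_def common_refinement by (auto simp: image_image Pi_iff)
  have "g (?P i) = {y. cell \<xi> ((f ^^ i) y) = cell \<xi> ((f ^^ i) x)}" if i: "i < n" for i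
  proof -
    obtain A where A: "A \<in> \<xi>" "g (?P i) = (f ^^ i) -` A" using g[OF i] by blast
    moreover have "(f ^^ i) x \<in> A" using A \<open>x \<in> D\<close> D i by auto
    ultimately show ?thesis using cell_eqI[OF part] cell_mem[OF part] by blast
  qed
  then show ?thesis unfolding D by auto
qed

lemma Union_dynamical_join:
  assumes "partition_on UNIV \<xi>"
  shows "\<Union> (dynamical_join f n \<xi>) = UNIV"
  using partition_onD1[OF assms] unfolding dynamical_join_def
  by (auto simp: Union_common_refinement)

text \<open>An explicit form of the continuity at \<open>0\<close> of the entropy function.\<close>

lemma minus_x_ln_x_le_sqrt:
  fixes x :: real
  assumes "0 \<le> x"
  shows "- (x * ln x) \<le> 2 * sqrt x"
proof (cases "x = 0")
  case False
  then have x: "x > 0" using assms by simp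
  have "ln (1 / sqrt x) \<le> 1 / sqrt x - 1" using x by (intro ln_le_minus_one) simp
  moreover have "ln (1 / sqrt x) = - (ln x / 2)" using x by (simp add: ln_div ln_sqrt)
  ultimately have "- ln x \<le> 2 / sqrt x" by simp
  then have "x * (- ln x) \<le> x * (2 / sqrt x)" using x by (intro mult_left_mono) auto
  also have "\<dots> = 2 * sqrt x" using x by (simp add: field_simps)
  finally show ?thesis by simp
qed simp

context invariant_probability
begin

lemma simple_functionI:
  assumes "finite R" and "range X \<subseteq> R" and "\<And>b. b \<in> R \<Longrightarrow> X -` {b} \<in> sets \<mu>"
  shows "simple_function \<mu> X"
  unfolding simple_function_def space_eq Int_UNIV_right
  using finite_subset[OF assms(2,1)] assms(2,3) by blast

lemma simple_cell:
  assumes "finite \<xi>" and "\<xi> \<subseteq> sets \<mu>" and part: "partition_on UNIV \<xi>"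
  shows "simple_function \<mu> (cell \<xi>)"
proof -
  have "cell \<xi> -` {A} = A" if "A \<in> \<xi>" for A
    using that cell_eqI[OF part] cell_mem[OF part] by blast
  moreover have "range (cell \<xi>) \<subseteq> \<xi>" using cell_mem[OF part] by blast
  ultimately show ?thesis using assms(1,2) by (intro simple_functionI[of \<xi>]) auto
qed

lemma partition_entropy_dynamical_join:
  assumes part: "partition_on UNIV \<xi>"
  shows "partition_entropy \<mu> (dynamical_join f n \<xi>) = label_entropy \<mu> (orbit_name (cell \<xi>) n)"
proof -
  let ?N = "orbit_name (cell \<xi>) n" and ?D = "dynamical_join f n \<xi>"
  have fib: "D = ?N -` {?N x}" if "D \<in> ?D" "x \<in> D" for D x
    using dynamical_join_mem_eq[OF part that] by (auto simp: orbit_name_eq_iff)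
  have "?D = (\<lambda>b. ?N -` {b}) ` range ?N"
  proof (intro equalityI subsetI)
    fix D assume D: "D \<in> ?D"
    then have "D \<noteq> {}" by (simp add: dynamical_join_def common_refinement_def)
    then show "D \<in> (\<lambda>b. ?N -` {b}) ` range ?N" using fib[OF D] by blast
  next
    fix D assume "D \<in> (\<lambda>b. ?N -` {b}) ` range ?N"
    then obtain x where D: "D = ?N -` {?N x}" by auto
    obtain E where "E \<in> ?D" "x \<in> E" using Union_dynamical_join[OF part, of f n] by blast
    then show "D \<in> ?D" using fib D by metis
  qed
  moreover have "inj_on (\<lambda>b. ?N -` {b}) (range ?N)" by (rule inj_onI) blast
  ultimately show ?thesis
    unfolding partition_entropy_def label_entropy_def by (simp add: sum.reindex)
qed

text \<open>The limit in the definition of the entropy of a partition exists, by Fekete's lemma.\<close>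

lemma entropy_wrt_partition_tendsto:
  assumes "finite \<xi>" and "\<xi> \<subseteq> sets \<mu>" and part: "partition_on UNIV \<xi>"
  shows "(\<lambda>n. ereal (label_entropy \<mu> (orbit_name (cell \<xi>) n) / real n))
    \<longlonglongrightarrow> entropy_wrt_partition f \<mu> \<xi>"
proof -
  obtain l where "(\<lambda>n. label_entropy \<mu> (orbit_name (cell \<xi>) n) / real n) \<longlonglongrightarrow> l"
    using entropy_orbit_name_convergent[OF simple_cell[OF assms]] by (auto simp: convergent_def)
  then have l: "(\<lambda>n. ereal (label_entropy \<mu> (orbit_name (cell \<xi>) n) / real n)) \<longlonglongrightarrow> ereal l"
    by simp
  then show ?thesis
    unfolding entropy_wrt_partition_def partition_entropy_dynamical_join[OF part]
    by (simp add: limI[OF l])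
qed

lemma measure_entropy_nonneg: "0 \<le> measure_entropy f \<mu>"
proof -
  have part: "finite {UNIV :: 'a set}" "{UNIV} \<subseteq> sets \<mu>" "partition_on UNIV {UNIV :: 'a set}"
    by (auto simp: partition_on_def sets_eq)
  have "0 \<le> entropy_wrt_partition f \<mu> {UNIV}"
    by (rule LIMSEQ_le_const[OF entropy_wrt_partition_tendsto[OF part]]) (auto simp: entropy_nonneg)
  also have "\<dots> \<le> measure_entropy f \<mu>"
    unfolding measure_entropy_def by (rule SUP_upper) (use part in \<open>auto simp: space_eq\<close>)
  finally show ?thesis .
qed

text \<open>
  A bound on the measure entropy follows from asymptotic bounds on the entropies of the orbit names,
  with an arbitrarily small loss for each partition.
\<close>

lemma measure_entropy_leI:
  assumes "\<And>\<xi> \<eta>. finite \<xi> \<Longrightarrow> \<xi> \<subseteq> sets \<mu> \<Longrightarrow> partition_on UNIV \<xi> \<Longrightarrow> \<eta> > 0 \<Longrightarrow>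
    \<forall>\<^sub>F n in sequentially. label_entropy \<mu> (orbit_name (cell \<xi>) n) \<le> real n * (b + \<eta>)"
  shows "measure_entropy f \<mu> \<le> ereal b"
  unfolding measure_entropy_def
proof (rule SUP_least, clarsimp simp: space_eq)
  fix \<xi> assume \<xi>: "finite \<xi>" "\<xi> \<subseteq> sets \<mu>" "partition_on UNIV \<xi>"
  show "entropy_wrt_partition f \<mu> \<xi> \<le> ereal b"
  proof (rule ereal_le_epsilon2)
    fix \<eta> :: real assume "0 < \<eta>"
    have "\<forall>\<^sub>F n in sequentially.
        ereal (label_entropy \<mu> (orbit_name (cell \<xi>) n) / real n) \<le> ereal (b + \<eta>)"
      using assms[OF \<xi> \<open>0 < \<eta>\<close>] eventually_gt_at_top[of 0]
      by eventually_elim (simp add: field_simps)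
    then show "entropy_wrt_partition f \<mu> \<xi> \<le> ereal b + ereal \<eta>"
      using tendsto_upperbound[OF entropy_wrt_partition_tendsto[OF \<xi>]] by simp
  qed
qed

text \<open>
  The map below takes the value \<open>None\<close> on the union of the closed sets \<open>B A\<close>, and remembers the
  cell of every other point.  Its entropy is small once the discarded parts \<open>A - B A\<close> have
  measure below \<open>s\<^sup>2\<close> for a small \<open>s\<close>: each of them contributes at most \<open>2 * s\<close>, and the remaining value
  contributes at most the total measure of the discarded parts.
\<close>

lemma closed_approximation_small_entropy:
  assumes \<xi>: "finite \<xi>" "\<xi> \<subseteq> sets \<mu>" "partition_on UNIV \<xi>" and "\<eta> > 0"
  shows "\<exists>B. (\<forall>A\<in>\<xi>. closed (B A) \<and> B A \<subseteq> A) \<and>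
    simple_function \<mu> (\<lambda>x. if x \<in> B (cell \<xi> x) then None else Some (cell \<xi> x)) \<and>
    label_entropy \<mu> (\<lambda>x. if x \<in> B (cell \<xi> x) then None else Some (cell \<xi> x)) \<le> \<eta>"
proof -
  define k where "k = real (card \<xi>)"
  have "\<xi> \<noteq> {}" using \<xi>(3) by (auto simp: partition_on_def)
  then have k: "k \<ge> 1" using \<xi>(1) by (simp add: k_def Suc_le_eq card_gt_0_iff)
  define s where "s = min 1 (\<eta> / (3 * k))"
  have s: "0 < s" "s \<le> 1" "3 * k * s \<le> \<eta>"
    using k \<open>\<eta> > 0\<close> by (auto simp: s_def min_def field_simps)
  have "\<forall>A\<in>\<xi>. \<exists>C. closed C \<and> C \<subseteq> A \<and> prob (A - C) < s\<^sup>2"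
  proof
    fix A assume "A \<in> \<xi>"
    then have A: "A \<in> sets borel" using \<xi>(2) sets_eq by auto
    obtain C U where CU: "closed C" "open U" "C \<subseteq> A" "A \<subseteq> U" "prob (U - C) < s\<^sup>2"
      using borel_regular_closed_open[OF finite_measure_axioms sets_eq A, of "s\<^sup>2"] s by auto
    have "prob (A - C) \<le> prob (U - C)"
      using CU by (intro finite_measure_mono) (auto simp: sets_eq)
    then show "\<exists>C. closed C \<and> C \<subseteq> A \<and> prob (A - C) < s\<^sup>2" using CU by (intro exI[of _ C]) auto
  qed
  then obtain B where B: "\<And>A. A \<in> \<xi> \<Longrightarrow> closed (B A)" "\<And>A. A \<in> \<xi> \<Longrightarrow> B A \<subseteq> A"
    "\<And>A. A \<in> \<xi> \<Longrightarrow> prob (A - B A) < s\<^sup>2" by metis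
  let ?Z = "\<lambda>x. if x \<in> B (cell \<xi> x) then None else Some (cell \<xi> x)"
  note cell = cell_eqI[OF \<xi>(3)] cell_mem[OF \<xi>(3)]
  have SomeZ: "?Z -` {Some A} = A - B A" if "A \<in> \<xi>" for A
    using that cell by (auto split: if_splits)
  have NoneZ: "?Z -` {None} = (\<Union>A\<in>\<xi>. B A)"
  proof (intro set_eqI iffI)
    fix x assume "x \<in> (\<Union>A\<in>\<xi>. B A)"
    then obtain A where "A \<in> \<xi>" "x \<in> B A" by blast
    then show "x \<in> ?Z -` {None}" using cell(1)[of A x] B(2)[of A] by auto
  qed (use cell(2) in \<open>auto split: if_splits\<close>)
  have rangeZ: "range ?Z \<subseteq> insert None (Some ` \<xi>)" using cell by auto
  have meas: "B A \<in> sets \<mu>" "A \<in> sets \<mu>" if "A \<in> \<xi>" for A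
    using B(1)[OF that] \<xi>(2) that by (auto simp: sets_eq)
  have measZ: "?Z -` {b} \<in> sets \<mu>" if "b \<in> insert None (Some ` \<xi>)" for b
  proof (cases b)
    case None
    show ?thesis unfolding None NoneZ using meas \<xi>(1) by (intro sets.finite_UN) auto
  next
    case (Some A)
    then have "A \<in> \<xi>" using that by auto
    then show ?thesis unfolding Some SomeZ[OF \<open>A \<in> \<xi>\<close>] using meas by (intro sets.Diff)
  qed
  have simple: "simple_function \<mu> ?Z"
    by (rule simple_functionI[OF _ rangeZ measZ]) (use \<xi>(1) in simp)
  define p where "p A = prob (A - B A)" for A
  define q where "q = prob (?Z -` {None})"
  have p: "0 \<le> p A" "sqrt (p A) \<le> s" "p A \<le> s" if "A \<in> \<xi>" for A
  proof -
    show "0 \<le> p A" by (simp add: p_def)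
    have "sqrt (p A) \<le> sqrt (s\<^sup>2)" using B(3)[OF that] by (intro real_sqrt_le_mono) (simp add: p_def)
    then show "sqrt (p A) \<le> s" using s by simp
    have "s\<^sup>2 \<le> s" using s by (simp add: power2_eq_square mult_le_cancel_right1)
    then show "p A \<le> s" using B(3)[OF that] by (simp add: p_def)
  qed
  have sum1: "q + (\<Sum>A\<in>\<xi>. p A) = 1"
  proof -
    have "(\<Union>b\<in>insert None (Some ` \<xi>). ?Z -` {b}) = space \<mu>"
      unfolding space_eq using rangeZ by blast
    then have "1 = prob (\<Union>b\<in>insert None (Some ` \<xi>). ?Z -` {b})"
      using prob_space by metis
    also have "\<dots> = (\<Sum>b\<in>insert None (Some ` \<xi>). prob (?Z -` {b}))"
      using \<xi>(1) measZ by (intro finite_measure_finite_Union) (auto simp: disjoint_family_on_def)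
    also have "\<dots> = q + (\<Sum>A\<in>\<xi>. prob (?Z -` {Some A}))"
      using \<xi>(1) by (subst sum.insert) (auto simp: sum.reindex q_def)
    also have "(\<Sum>A\<in>\<xi>. prob (?Z -` {Some A})) = (\<Sum>A\<in>\<xi>. p A)"
      using SomeZ by (intro sum.cong) (auto simp: p_def)
    finally show ?thesis by simp
  qed
  have q: "- (q * ln q) \<le> 1 - q"
  proof (cases "q = 0")
    case False
    then have q0: "q > 0" by (simp add: q_def zero_less_measure_iff)
    have "ln (1 / q) \<le> 1 / q - 1" using q0 by (intro ln_le_minus_one) simp
    then have "q * ln (1 / q) \<le> q * (1 / q - 1)" using q0 by (intro mult_left_mono) auto
    then show ?thesis using q0 by (simp add: ln_div right_diff_distrib)
  qed simp
  have "label_entropy \<mu> ?Z = - (\<Sum>b\<in>insert None (Some ` \<xi>). prob (?Z -` {b}) * ln (prob (?Z -` {b})))"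
    using \<xi>(1) by (intro entropy_eq_sum rangeZ) simp
  also have "\<dots> = - (q * ln q) - (\<Sum>A\<in>\<xi>. prob (?Z -` {Some A}) * ln (prob (?Z -` {Some A})))"
    using \<xi>(1) by (subst sum.insert) (auto simp: sum.reindex q_def)
  also have "(\<Sum>A\<in>\<xi>. prob (?Z -` {Some A}) * ln (prob (?Z -` {Some A}))) = (\<Sum>A\<in>\<xi>. p A * ln (p A))"
    by (intro sum.cong refl) (simp only: SomeZ p_def)
  also have "- (q * ln q) - (\<Sum>A\<in>\<xi>. p A * ln (p A)) \<le> (\<Sum>A\<in>\<xi>. p A) + (\<Sum>A\<in>\<xi>. - (p A * ln (p A)))"
    using q sum1 by (simp add: sum_negf)
  also have "\<dots> = (\<Sum>A\<in>\<xi>. p A + - (p A * ln (p A)))"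
    by (rule sum.distrib[symmetric])
  also have "\<dots> \<le> (\<Sum>A\<in>\<xi>. s + 2 * s)"
  proof (rule sum_mono)
    fix A assume "A \<in> \<xi>"
    then show "p A + - (p A * ln (p A)) \<le> s + 2 * s"
      using p[of A] minus_x_ln_x_le_sqrt[of "p A"] by linarith
  qed
  also have "\<dots> = 3 * k * s" by (simp add: k_def)
  also note s(3)
  finally show ?thesis using B simple by blast
qed

text \<open>Every finite measurable cover admits a measurable choice of a member containing the given point.\<close>

lemma finite_cover_selector:
  assumes "finite L" and "\<And>l. l \<in> L \<Longrightarrow> C l \<in> sets \<mu>" and "(\<Union>l\<in>L. C l) = UNIV"
  shows "\<exists>c. simple_function \<mu> c \<and> (\<forall>x. c x \<in> L \<and> x \<in> C (c x))"
proof -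
  obtain h N where h: "bij_betw h {..<N::nat} L"
    using ex_bij_betw_nat_finite[OF assms(1)] by (auto simp: atLeast0LessThan)
  define P where "P x i \<longleftrightarrow> i < N \<and> x \<in> C (h i)" for x i
  define idx where "idx x = (LEAST i. P x i)" for x
  have ex: "\<exists>i. P x i" for x
  proof -
    obtain l where "l \<in> L" "x \<in> C l" using assms(3) by blast
    then show ?thesis using h by (auto simp: P_def bij_betw_def)
  qed
  have idx: "P x (idx x)" for x unfolding idx_def using ex[of x] by (auto intro: LeastI_ex)
  have fib: "idx -` {i} = C (h i) - (\<Union>j<i. C (h j))" if "i < N" for i
  proof (intro set_eqI iffI)
    fix x assume "x \<in> idx -` {i}"
    then have i: "idx x = i" by simp
    have "\<not> P x j" if "j < i" for j using not_less_Least[of j "P x"] that i by (simp add: idx_def)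
    then show "x \<in> C (h i) - (\<Union>j<i. C (h j))" using idx[of x] i that by (auto simp: P_def)
  next
    fix x assume x: "x \<in> C (h i) - (\<Union>j<i. C (h j))"
    then have "P x i" using that by (simp add: P_def)
    moreover have "i \<le> j" if "P x j" for j using that x by (meson DiffD2 P_def UN_I lessThan_iff not_le)
    ultimately show "x \<in> idx -` {i}" unfolding idx_def by (simp add: Least_equality)
  qed
  have hL: "h i \<in> L" if "i < N" for i using h that by (auto simp: bij_betw_def)
  have range: "range idx \<subseteq> {..<N}" using idx by (auto simp: P_def)
  have "idx -` {i} \<in> sets \<mu>" if "i < N" for i
    unfolding fib[OF that] using that by (intro sets.Diff sets.finite_UN assms(2) hL) auto
  then have "simple_function \<mu> idx"
    by (intro simple_functionI[OF _ range]) auto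
  then have "simple_function \<mu> (h \<circ> idx)" by (rule simple_function_compose)
  then show ?thesis using idx hL by (intro exI[of _ "h \<circ> idx"]) (auto simp: P_def)
qed

text \<open>
  At a small scale \<open>r\<close> the position of a point up to distance \<open>r\<close> determines its cell, up to
  the information carried by a map \<open>Z\<close> of entropy at most \<open>\<eta>\<close>: if \<open>Z\<close> is \<open>None\<close> at both points,
  they lie in the closed cores of their cells, and distinct cores are at least \<open>r\<close> apart.
\<close>

lemma partition_coding_at_small_scale:
  assumes cpt: "compact (UNIV :: 'a set)"
    and \<xi>: "finite \<xi>" "\<xi> \<subseteq> sets \<mu>" "partition_on UNIV \<xi>" and "\<eta> > 0"
  obtains r and Z :: "'a \<Rightarrow> 'a set option"
  where "r > 0" and "simple_function \<mu> Z" and "label_entropy \<mu> Z \<le> \<eta>"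
    and "\<And>x y. Z x = Z y \<Longrightarrow> dist x y < r \<Longrightarrow> cell \<xi> x = cell \<xi> y"
proof -
  obtain B where B: "\<And>A. A \<in> \<xi> \<Longrightarrow> closed (B A)" "\<And>A. A \<in> \<xi> \<Longrightarrow> B A \<subseteq> A"
    and Z: "simple_function \<mu> (\<lambda>x. if x \<in> B (cell \<xi> x) then None else Some (cell \<xi> x))"
      "label_entropy \<mu> (\<lambda>x. if x \<in> B (cell \<xi> x) then None else Some (cell \<xi> x)) \<le> \<eta>"
    using closed_approximation_small_entropy[OF \<xi> \<open>\<eta> > 0\<close>] by blast
  have "B A \<inter> B A' = {}" if "A \<in> \<xi>" "A' \<in> \<xi>" "A \<noteq> A'" for A A'
  proof -
    have "A \<inter> A' = {}" using partition_onD2[OF \<xi>(3)] that by (auto simp: disjoint_def)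
    then show ?thesis using B(2) that by blast
  qed
  then obtain r where r: "r > 0"
    "\<And>A A' x y. A \<in> \<xi> \<Longrightarrow> A' \<in> \<xi> \<Longrightarrow> x \<in> B A \<Longrightarrow> y \<in> B A' \<Longrightarrow> dist x y < r \<Longrightarrow> A = A'"
    using separated_closed_family[OF cpt \<xi>(1), of B] B(1) by metis
  show ?thesis
    by (rule that[OF r(1) Z])
      (use r(2)[OF cell_mem(1)[OF \<xi>(3)] cell_mem(1)[OF \<xi>(3)]] in \<open>auto split: if_splits\<close>)
qed

text \<open>
  The central estimate.  The sets \<open>C l\<close> cover the space, and orbits that start in the same set stay
  less than \<open>r\<close> apart for time \<open>n\<close>.  The \<open>n\<close>-name of a point is determined by a chosen \<open>l\<close> with the point
  in \<open>C l\<close> and by its \<open>n\<close>-name under \<open>Z\<close>; the entropy of the latter is at most \<open>n * \<eta>\<close>, and the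
  Gibbs inequality controls the entropy of the choice together with the integral of \<open>g\<close>.
\<close>

lemma entropy_le_cover_sum:
  assumes Z: "simple_function \<mu> Z" "label_entropy \<mu> Z \<le> \<eta>"
    and det: "\<And>x y. Z x = Z y \<Longrightarrow> dist x y < r \<Longrightarrow> X x = X y"
    and L: "finite L" "\<And>l. l \<in> L \<Longrightarrow> C l \<in> sets \<mu>" "(\<Union>l\<in>L. C l) = UNIV"
    and diam: "\<And>l x y i. l \<in> L \<Longrightarrow> x \<in> C l \<Longrightarrow> y \<in> C l \<Longrightarrow> i < n \<Longrightarrow> dist ((f ^^ i) x) ((f ^^ i) y) < r"
    and g: "integrable \<mu> g" and a: "\<And>l x. l \<in> L \<Longrightarrow> x \<in> C l \<Longrightarrow> g x \<le> a l"
  shows "label_entropy \<mu> (orbit_name X n) + (\<integral>x. g x \<partial>\<mu>) \<le> real n * \<eta> + ln (\<Sum>l\<in>L. exp (a l))"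
proof -
  obtain c where c: "simple_function \<mu> c" "\<And>x. c x \<in> L" "\<And>x. x \<in> C (c x)"
    using finite_cover_selector[of L C] L by blast
  have simpleN: "simple_function \<mu> (orbit_name Z n)" by (rule simple_orbit_name[OF Z(1)])
  have "label_entropy \<mu> (orbit_name X n) \<le> label_entropy \<mu> (\<lambda>x. (c x, orbit_name Z n x))"
  proof (rule entropy_mono_determined)
    show "simple_function \<mu> (\<lambda>x. (c x, orbit_name Z n x))"
      by (intro simple_function_Pair c simpleN)
    fix x y assume "(c x, orbit_name Z n x) = (c y, orbit_name Z n y)"
    then have eq: "c x = c y" "\<And>i. i < n \<Longrightarrow> Z ((f ^^ i) x) = Z ((f ^^ i) y)"
      by (auto simp: orbit_name_eq_iff)
    then show "orbit_name X n x = orbit_name X n y"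
      using diam[OF c(2,3)[of x]] c(3)[of y] by (auto simp: orbit_name_eq_iff intro: det)
  qed
  also have "\<dots> \<le> label_entropy \<mu> c + label_entropy \<mu> (orbit_name Z n)"
    by (intro entropy_subadditive c simpleN)
  also have "label_entropy \<mu> (orbit_name Z n) \<le> real n * \<eta>"
    using entropy_orbit_name_le[OF Z(1), of n] Z(2)
    by (meson mult_left_mono of_nat_0_le_iff order_trans)
  finally have 1: "label_entropy \<mu> (orbit_name X n) \<le> label_entropy \<mu> c + real n * \<eta>" by simp
  have "integrable \<mu> (\<lambda>x. a (c x))"
  proof (rule integrable_const_bound[of _ "\<Sum>l\<in>L. \<bar>a l\<bar>"])
    show "AE x in \<mu>. norm (a (c x)) \<le> (\<Sum>l\<in>L. \<bar>a l\<bar>)"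
      using c(2) L(1) by (intro AE_I2) (auto intro!: member_le_sum[of _ L "\<lambda>l. \<bar>a l\<bar>"])
    show "(\<lambda>x. a (c x)) \<in> borel_measurable \<mu>"
      using simple_function_compose[OF c(1), of a] by (auto simp: comp_def intro: borel_measurable_simple_function)
  qed
  then have "(\<integral>x. g x \<partial>\<mu>) \<le> (\<integral>x. a (c x) \<partial>\<mu>)"
    using g a c by (intro integral_mono) auto
  moreover have "label_entropy \<mu> c + (\<integral>x. a (c x) \<partial>\<mu>) \<le> ln (\<Sum>l\<in>L. exp (a l))"
    using c by (intro gibbs_inequality L(1)) auto
  ultimately show ?thesis using 1 by linarith
qed

end

section \<open>Spanning sets and the induced pressure\<close>

text \<open>
  For a quantity that grows as the scale shrinks, the limit at scale \<open>0\<close> exists and is its supremum.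
\<close>

lemma antimono_le_Lim_at_right_0:
  fixes g :: "real \<Rightarrow> ereal"
  assumes anti: "\<And>\<delta> \<epsilon>. 0 < \<delta> \<Longrightarrow> \<delta> \<le> \<epsilon> \<Longrightarrow> g \<epsilon> \<le> g \<delta>" and "0 < \<epsilon>"
  shows "g \<epsilon> \<le> Lim (at_right 0) g"
proof -
  have "(g \<longlongrightarrow> (SUP \<epsilon>\<in>{0<..}. g \<epsilon>)) (at_right 0)"
  proof (rule order_tendstoI)
    fix a assume "a < (SUP \<epsilon>\<in>{0<..}. g \<epsilon>)"
    then obtain \<epsilon>0 where "\<epsilon>0 > 0" "a < g \<epsilon>0" by (auto simp: less_SUP_iff)
    then show "\<forall>\<^sub>F \<epsilon> in at_right 0. a < g \<epsilon>"
      unfolding eventually_at_right_field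
      by (intro exI[of _ \<epsilon>0]) (auto intro: less_le_trans[OF _ anti])
  next
    fix a assume "(SUP \<epsilon>\<in>{0<..}. g \<epsilon>) < a"
    then show "\<forall>\<^sub>F \<epsilon> in at_right 0. g \<epsilon> < a"
      unfolding eventually_at_right_field
      by (intro exI[of _ 1]) (auto intro: le_less_trans[OF SUP_upper])
  qed
  then have "Lim (at_right 0) g = (SUP \<epsilon>\<in>{0<..}. g \<epsilon>)"
    by (intro tendsto_Lim) simp_all
  then show ?thesis using \<open>0 < \<epsilon>\<close> by (auto intro: SUP_upper)
qed

lemma bowen_dist_le_iff:
  assumes "n \<ge> 1"
  shows "bowen_dist f n x y \<le> \<epsilon> \<longleftrightarrow> (\<forall>i<n. dist ((f ^^ i) x) ((f ^^ i) y) \<le> \<epsilon>)"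
proof -
  have "0 \<in> {..<n}" using assms by simp
  then have "{..<n} \<noteq> {}" by blast
  then show ?thesis unfolding bowen_dist_def by (subst Max_le_iff) auto
qed

lemma continuous_on_funpow:
  fixes f :: "'a::topological_space \<Rightarrow> 'a"
  assumes "continuous_on UNIV f"
  shows "continuous_on UNIV (f ^^ i)"
proof (induction i)
  case (Suc i)
  have "continuous_on UNIV (f \<circ> f ^^ i)"
    by (rule continuous_on_compose[OF Suc continuous_on_subset[OF assms]]) simp
  then show ?case by (simp only: funpow.simps)
qed simp

lemma continuous_on_birkhoff_sum:
  assumes "continuous_on UNIV f" and "continuous_on UNIV \<phi>"
  shows "continuous_on UNIV (birkhoff_sum f \<phi> n)"
  unfolding birkhoff_sum_def
  by (rule continuous_on_sum, rule continuous_on_compose2[OF assms(2) continuous_on_funpow[OF assms(1)] subset_UNIV])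

lemma closed_bowen_ball:
  assumes "continuous_on UNIV f" and "n \<ge> 1"
  shows "closed {y. bowen_dist f n x y \<le> \<epsilon>}"
  unfolding bowen_dist_le_iff[OF assms(2)]
proof -
  have "{y. \<forall>i<n. dist ((f ^^ i) x) ((f ^^ i) y) \<le> \<epsilon>} = (\<Inter>i\<in>{..<n}. {y. dist ((f ^^ i) x) ((f ^^ i) y) \<le> \<epsilon>})"
    by auto
  moreover have "closed {y. dist ((f ^^ i) x) ((f ^^ i) y) \<le> \<epsilon>}" for i
    by (intro closed_Collect_le continuous_intros continuous_on_funpow assms)
  ultimately show "closed {y. \<forall>i<n. dist ((f ^^ i) x) ((f ^^ i) y) \<le> \<epsilon>}" by auto
qed

lemma finite_spanning_set_exists:
  fixes f :: "'a::metric_space \<Rightarrow> 'a"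
  assumes cpt: "compact (UNIV :: 'a set)" and f: "continuous_on UNIV f" and "n \<ge> 1" and "\<epsilon> > 0"
  shows "\<exists>F. finite F \<and> spanning_set f n \<epsilon> UNIV F"
proof -
  let ?U = "\<lambda>x. \<Inter>i\<in>{..<n}. {y. dist ((f ^^ i) x) ((f ^^ i) y) < \<epsilon>}"
  have "open (?U x)" for x
    by (intro open_INT finite_lessThan ballI open_Collect_less continuous_intros
        continuous_on_funpow f)
  moreover have "UNIV \<subseteq> (\<Union>x\<in>UNIV. ?U x)"
  proof
    fix y show "y \<in> (\<Union>x\<in>UNIV. ?U x)" using \<open>\<epsilon> > 0\<close> by (intro UN_I[of y]) auto
  qed
  ultimately obtain F where F: "F \<subseteq> UNIV" "finite F" "UNIV \<subseteq> (\<Union>x\<in>F. ?U x)"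
    by (rule compactE_image[OF cpt, of UNIV ?U]) blast
  have "spanning_set f n \<epsilon> UNIV F"
    unfolding spanning_set_def bowen_dist_le_iff[OF \<open>n \<ge> 1\<close>]
  proof
    fix y obtain x where "x \<in> F" "y \<in> ?U x" using F(3) by blast
    then show "\<exists>x\<in>F. \<forall>i<n. dist ((f ^^ i) x) ((f ^^ i) y) \<le> \<epsilon>"
      by (intro bexI[of _ x]) (auto intro: less_imp_le)
  qed
  with F(2) show ?thesis by (intro exI[of _ F] conjI)
qed

lemma spanning_number_attained:
  fixes f :: "'a::metric_space \<Rightarrow> 'a"
  assumes "compact (UNIV :: 'a set)" and "continuous_on UNIV f" and "n \<ge> 1" and "\<epsilon> > 0"
  shows "\<exists>F. finite F \<and> spanning_set f n \<epsilon> UNIV F \<and> card F = spanning_number f n \<epsilon>"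
proof -
  have "{card F |F. finite F \<and> spanning_set f n \<epsilon> UNIV F} \<noteq> {}"
    using finite_spanning_set_exists[OF assms] by blast
  from Inf_nat_def1[OF this] show ?thesis unfolding spanning_number_def by auto
qed

lemma spanning_set_mono:
  "spanning_set f n \<delta> Z F \<Longrightarrow> \<delta> \<le> \<epsilon> \<Longrightarrow> spanning_set f n \<epsilon> Z F"
  unfolding spanning_set_def by force

lemma spanning_number_pos:
  fixes f :: "'a::metric_space \<Rightarrow> 'a"
  assumes "compact (UNIV :: 'a set)" and "continuous_on UNIV f" and "n \<ge> 1" and "\<epsilon> > 0"
  shows "spanning_number f n \<epsilon> > 0"
proof -
  obtain F where F: "finite F" "spanning_set f n \<epsilon> UNIV F" "card F = spanning_number f n \<epsilon>"
    using spanning_number_attained[OF assms] by blast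
  then have "F \<noteq> {}" by (auto simp: spanning_set_def)
  then show ?thesis using F by (metis card_gt_0_iff)
qed

lemma spanning_number_antimono:
  fixes f :: "'a::metric_space \<Rightarrow> 'a"
  assumes "compact (UNIV :: 'a set)" and "continuous_on UNIV f" and "n \<ge> 1" and "\<delta> > 0" and "\<delta> \<le> \<epsilon>"
  shows "spanning_number f n \<epsilon> \<le> spanning_number f n \<delta>"
proof -
  obtain F where F: "finite F" "spanning_set f n \<delta> UNIV F" "card F = spanning_number f n \<delta>"
    using spanning_number_attained[OF assms(1-4)] by blast
  then have "card F \<in> {card F |F. finite F \<and> spanning_set f n \<epsilon> UNIV F}"
    using spanning_set_mono[OF F(2) assms(5)] by blast
  then have "spanning_number f n \<epsilon> \<le> card F"
    unfolding spanning_number_def by (intro cInf_lower) simp_all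
  then show ?thesis using F(3) by simp
qed

lemma limsup_spanning_number_le:
  fixes f :: "'a::metric_space \<Rightarrow> 'a"
  assumes "compact (UNIV :: 'a set)" and "continuous_on UNIV f" and "\<epsilon> > 0"
  shows "limsup (\<lambda>n. ereal (ln (real (spanning_number f n \<epsilon>)) / real n)) \<le> topological_entropy f"
  unfolding topological_entropy_def
proof (rule antimono_le_Lim_at_right_0[OF _ \<open>\<epsilon> > 0\<close>])
  fix \<delta> \<epsilon> :: real assume "0 < \<delta>" "\<delta> \<le> \<epsilon>"
  show "limsup (\<lambda>n. ereal (ln (real (spanning_number f n \<epsilon>)) / real n))
      \<le> limsup (\<lambda>n. ereal (ln (real (spanning_number f n \<delta>)) / real n))"
  proof (rule Limsup_mono, rule eventually_mono[OF eventually_ge_at_top[of 1]])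
    fix n :: nat assume n: "1 \<le> n"
    have "0 < spanning_number f n \<epsilon>" "spanning_number f n \<epsilon> \<le> spanning_number f n \<delta>"
      using spanning_number_pos[OF assms(1,2) n] spanning_number_antimono[OF assms(1,2) n]
        \<open>0 < \<delta>\<close> \<open>\<delta> \<le> \<epsilon>\<close> by auto
    then show "ereal (ln (real (spanning_number f n \<epsilon>)) / real n)
        \<le> ereal (ln (real (spanning_number f n \<delta>)) / real n)"
      by (simp add: divide_right_mono)
  qed
qed

lemma induced_Q_antimono:
  assumes "\<delta> \<le> \<epsilon>"
  shows "induced_Q f \<psi> \<phi> T \<epsilon> \<le> induced_Q f \<psi> \<phi> T \<delta>"
  unfolding induced_Q_def
  by (rule INF_superset_mono) (use spanning_set_mono[OF _ assms] in blast)+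

lemma ln_ennreal_mono:
  assumes "p \<le> q"
  shows "ln_ennreal p \<le> ln_ennreal q"
proof (cases "p = 0 \<or> q = \<infinity>")
  case False
  then obtain b where b: "q = ennreal b" "0 \<le> b" by (cases q) auto
  moreover obtain a where a: "p = ennreal a" "0 \<le> a" using assms b by (cases p) (auto simp: top_unique)
  ultimately have "0 < a" "a \<le> b" using False assms by (auto simp: order_less_le)
  then show ?thesis using a b by (simp add: ln_ennreal_def)
qed (auto simp: ln_ennreal_def)

lemma Limsup_induced_Q_le:
  assumes "\<epsilon> > 0"
  shows "Limsup at_top (\<lambda>T. ereal (1 / T) * ln_ennreal (induced_Q f \<psi> \<phi> T \<epsilon>)) \<le> induced_pressure f \<psi> \<phi>"
  unfolding induced_pressure_def
proof (rule antimono_le_Lim_at_right_0[OF _ assms])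
  fix \<delta> \<epsilon> :: real assume "0 < \<delta>" "\<delta> \<le> \<epsilon>"
  show "Limsup at_top (\<lambda>T. ereal (1 / T) * ln_ennreal (induced_Q f \<psi> \<phi> T \<epsilon>))
      \<le> Limsup at_top (\<lambda>T. ereal (1 / T) * ln_ennreal (induced_Q f \<psi> \<phi> T \<delta>))"
  proof (rule Limsup_mono, rule eventually_mono[OF eventually_gt_at_top[of 0]])
    fix T :: real assume "0 < T"
    then show "ereal (1 / T) * ln_ennreal (induced_Q f \<psi> \<phi> T \<epsilon>)
        \<le> ereal (1 / T) * ln_ennreal (induced_Q f \<psi> \<phi> T \<delta>)"
      using \<open>\<delta> \<le> \<epsilon>\<close> by (intro ereal_mult_left_mono ln_ennreal_mono induced_Q_antimono) auto
  qed
qed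

lemma less_exp_if_ln_ennreal_less:
  assumes "T > 0" and "ereal (1 / T) * ln_ennreal q < ereal s"
  shows "q < ennreal (exp (s * T))"
proof -
  consider "q = 0" | "q = \<infinity>" | "q \<noteq> 0" "q \<noteq> \<infinity>" by blast
  then show ?thesis
  proof cases
    case 2
    then show ?thesis using assms by (simp add: ln_ennreal_def)
  next
    case 3
    then have pos: "enn2real q > 0" by (simp add: enn2real_positive_iff less_top zero_less_iff_neq_zero)
    have "ln (enn2real q) < s * T" using 3 assms by (simp add: ln_ennreal_def field_simps)
    then have "enn2real q < exp (s * T)" using pos by (metis exp_less_mono exp_ln)
    then have "ennreal (enn2real q) < ennreal (exp (s * T))" by (simp add: ennreal_lessI)
    then show ?thesis using 3 by (simp add: less_top)
  qed simp
qed

text \<open>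
  A bound on \<open>Q\<close> yields, at each level time, a spanning set of bounded weight.  It is finite because
  the weights of its points are bounded below by \<open>exp (- K)\<close>.
\<close>

lemma spanning_family_exists:
  fixes f :: "'a::metric_space \<Rightarrow> 'a"
  assumes Q: "induced_Q f \<psi> \<phi> T \<epsilon> < ennreal w" and K: "\<And>x. - K \<le> birkhoff_sum f \<phi> n x"
    and n: "n \<in> level_times f \<psi> T"
  shows "\<exists>F. finite F \<and> spanning_set f n \<epsilon> (level_set f \<psi> T n) F \<and>
    (\<Sum>x\<in>F. exp (birkhoff_sum f \<phi> n x)) \<le> w"
proof -
  obtain F where F: "\<And>n. n \<in> level_times f \<psi> T \<Longrightarrow> spanning_set f n \<epsilon> (level_set f \<psi> T n) (F n)"
    "(\<Sum>\<^sub>\<infinity>n\<in>level_times f \<psi> T. \<Sum>\<^sub>\<infinity>x\<in>F n. ennreal (exp (birkhoff_sum f \<phi> n x))) < ennreal w"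
    using Q unfolding induced_Q_def by (auto simp: INF_less_iff)
  have w: "w > 0" using F(2) by (cases "w > 0") (auto simp: ennreal_neg)
  have "(\<Sum>\<^sub>\<infinity>x\<in>F n. ennreal (exp (birkhoff_sum f \<phi> n x))) =
      (\<Sum>\<^sub>\<infinity>n\<in>{n}. \<Sum>\<^sub>\<infinity>x\<in>F n. ennreal (exp (birkhoff_sum f \<phi> n x)))" by simp
  also have "\<dots> \<le> (\<Sum>\<^sub>\<infinity>n\<in>level_times f \<psi> T. \<Sum>\<^sub>\<infinity>x\<in>F n. ennreal (exp (birkhoff_sum f \<phi> n x)))"
    using n by (intro infsum_mono_neutral nonneg_summable_on_complete) auto
  also note F(2)
  finally have le: "(\<Sum>\<^sub>\<infinity>x\<in>F n. ennreal (exp (birkhoff_sum f \<phi> n x))) < ennreal w" .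
  have part: "(\<Sum>x\<in>G. exp (birkhoff_sum f \<phi> n x)) \<le> w" if "finite G" "G \<subseteq> F n" for G
  proof -
    have "ennreal (\<Sum>x\<in>G. exp (birkhoff_sum f \<phi> n x)) = (\<Sum>\<^sub>\<infinity>x\<in>G. ennreal (exp (birkhoff_sum f \<phi> n x)))"
      using that(1) by (simp add: sum_ennreal)
    also have "\<dots> \<le> (\<Sum>\<^sub>\<infinity>x\<in>F n. ennreal (exp (birkhoff_sum f \<phi> n x)))"
      using that(2) by (intro infsum_mono_neutral nonneg_summable_on_complete) auto
    also note le
    finally show ?thesis using w by (simp add: ennreal_less_iff sum_nonneg)
  qed
  have "finite (F n)"
  proof (rule ccontr)
    assume "infinite (F n)"
    obtain N :: nat where N: "w / exp (- K) < real N" using reals_Archimedean2 by blast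
    obtain G where G: "G \<subseteq> F n" "finite G" "card G = N"
      using infinite_arbitrarily_large[OF \<open>infinite (F n)\<close>, of N] by blast
    have "real N * exp (- K) = (\<Sum>x\<in>G. exp (- K))" using G by simp
    also have "\<dots> \<le> (\<Sum>x\<in>G. exp (birkhoff_sum f \<phi> n x))" using K by (intro sum_mono) simp
    also have "\<dots> \<le> w" by (rule part) (use G in auto)
    finally show False using N by (simp add: field_simps)
  qed
  with F(1)[OF n] part[OF this subset_refl] show ?thesis by (intro exI[of _ "F n"] conjI)
qed

section \<open>Measure entropy versus topological entropy and induced pressure\<close>

context invariant_probability
begin

lemma borel_measurable_continuous:
  "continuous_on UNIV g \<Longrightarrow> (g :: 'a \<Rightarrow> real) \<in> borel_measurable \<mu>"
  using borel_measurable_continuous_onI[of g] by (simp cong: measurable_cong_sets add: sets_eq)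

lemma integrable_continuous:
  fixes g :: "'a \<Rightarrow> real"
  assumes "compact (UNIV :: 'a set)" and "continuous_on UNIV g"
  shows "integrable \<mu> g"
proof -
  have "bounded (range g)" using compact_continuous_image[OF assms(2,1)] by (rule compact_imp_bounded)
  then obtain B where "\<And>x. norm (g x) \<le> B" by (auto simp: bounded_iff)
  then show ?thesis
    using borel_measurable_continuous[OF assms(2)] by (intro integrable_const_bound[of _ B]) auto
qed

lemma integral_birkhoff_sum:
  assumes cpt: "compact (UNIV :: 'a set)" and g: "continuous_on UNIV g"
  shows "(\<integral>x. birkhoff_sum f g n x \<partial>\<mu>) = real n * (\<integral>x. g x \<partial>\<mu>)"
proof -
  have "integrable \<mu> (\<lambda>x. g ((f ^^ i) x))" for i
    by (rule integrable_continuous[OF cpt])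
      (rule continuous_on_compose2[OF g continuous_on_funpow[OF continuous_f] subset_UNIV])
  moreover have "(\<integral>x. g ((f ^^ i) x) \<partial>\<mu>) = (\<integral>x. g x \<partial>\<mu>)" for i
    using integral_distr[OF measurable_iterate borel_measurable_continuous[OF g], of i]
    by (simp add: distr_iterate)
  ultimately show ?thesis
    unfolding birkhoff_sum_def by (subst Bochner_Integration.integral_sum) simp_all
qed

text \<open>
  The bound by the topological entropy: the central estimate with \<open>g = 0\<close>, \<open>a = 0\<close> and the Bowen
  balls around a minimal spanning set.
\<close>

lemma measure_entropy_finite:
  assumes cpt: "compact (UNIV :: 'a set)" and top: "topological_entropy f < \<infinity>"
  shows "measure_entropy f \<mu> < \<infinity>"
proof -
  obtain s :: real where s: "topological_entropy f < ereal s"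
    using top ereal_dense2 by blast
  have "measure_entropy f \<mu> \<le> ereal s"
  proof (rule measure_entropy_leI)
    fix \<xi> :: "'a set set" and \<eta> :: real assume \<xi>: "finite \<xi>" "\<xi> \<subseteq> sets \<mu>" "partition_on UNIV \<xi>" and \<eta>: "\<eta> > 0"
    obtain r and Z :: "'a \<Rightarrow> 'a set option" where "r > 0"
      and Z: "simple_function \<mu> Z" "label_entropy \<mu> Z \<le> \<eta>"
        "\<And>x y. Z x = Z y \<Longrightarrow> dist x y < r \<Longrightarrow> cell \<xi> x = cell \<xi> y"
      using partition_coding_at_small_scale[OF cpt \<xi> \<eta>] by metis
    define \<epsilon> where "\<epsilon> = r / 3"
    have \<epsilon>: "\<epsilon> > 0" "2 * \<epsilon> < r" using \<open>r > 0\<close> by (auto simp: \<epsilon>_def)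
    have "limsup (\<lambda>n. ereal (ln (real (spanning_number f n \<epsilon>)) / real n)) < ereal s"
      using limsup_spanning_number_le[OF cpt continuous_f \<epsilon>(1)] s by (rule le_less_trans)
    from Limsup_lessD[OF this] eventually_ge_at_top[of 1]
    show "\<forall>\<^sub>F n in sequentially. label_entropy \<mu> (orbit_name (cell \<xi>) n) \<le> real n * (s + \<eta>)"
    proof eventually_elim
      fix n :: nat
      assume lt: "ereal (ln (real (spanning_number f n \<epsilon>)) / real n) < ereal s" and n: "1 \<le> n"
      obtain F where F: "finite F" "spanning_set f n \<epsilon> UNIV F" "card F = spanning_number f n \<epsilon>"
        using spanning_number_attained[OF cpt continuous_f n \<epsilon>(1)] by blast
      have "label_entropy \<mu> (orbit_name (cell \<xi>) n) + (\<integral>x. 0 \<partial>\<mu>) \<le> real n * \<eta> + ln (\<Sum>l\<in>F. exp 0)"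
      proof (rule entropy_le_cover_sum[OF Z, where C = "\<lambda>x. {y. bowen_dist f n x y \<le> \<epsilon>}"])
        fix x y z i assume "y \<in> {y. bowen_dist f n x y \<le> \<epsilon>}" "z \<in> {y. bowen_dist f n x y \<le> \<epsilon>}" "i < n"
        then have "dist ((f ^^ i) x) ((f ^^ i) y) \<le> \<epsilon>" "dist ((f ^^ i) x) ((f ^^ i) z) \<le> \<epsilon>"
          by (auto simp: bowen_dist_le_iff[OF n])
        then show "dist ((f ^^ i) y) ((f ^^ i) z) < r"
          using \<epsilon>(2) dist_triangle3[of "(f ^^ i) y" "(f ^^ i) z" "(f ^^ i) x"] by linarith
      next
        show "(\<Union>x\<in>F. {y. bowen_dist f n x y \<le> \<epsilon>}) = UNIV"
          using F(2) by (auto simp: spanning_set_def)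
      qed (use F(1) closed_bowen_ball[OF continuous_f n] in \<open>auto simp: sets_eq\<close>)
      then have "label_entropy \<mu> (orbit_name (cell \<xi>) n) \<le> real n * \<eta> + ln (real (spanning_number f n \<epsilon>))"
        using F(3) by simp
      moreover have "ln (real (spanning_number f n \<epsilon>)) \<le> real n * s"
        using lt n by (simp add: field_simps)
      ultimately show "label_entropy \<mu> (orbit_name (cell \<xi>) n) \<le> real n * (s + \<eta>)"
        by (simp add: algebra_simps)
    qed
  qed
  also have "\<dots> < \<infinity>" by simp
  finally show ?thesis .
qed

lemma eventually_ln_linear_le:
  assumes "c > 0" and "\<eta> > 0"
  shows "\<forall>\<^sub>F n in sequentially. ln (c * real n) + b \<le> real n * (\<eta> :: real)"
proof -
  have "(\<lambda>n. ln (real n) / real n + (ln c + b) / real n) \<longlonglongrightarrow> 0 + 0"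
    by (intro tendsto_add lim_ln_over_n lim_const_over_n)
  then have "\<forall>\<^sub>F n in sequentially. ln (real n) / real n + (ln c + b) / real n < \<eta>"
    by (rule order_tendstoD(2)) (use \<open>\<eta> > 0\<close> in simp)
  then show ?thesis using eventually_gt_at_top[of 0]
    by eventually_elim (use \<open>c > 0\<close> in \<open>simp add: ln_mult field_simps\<close>)
qed

text \<open>
  The half of the variational principle for the induced pressure that bounds measure entropies.
\<close>

lemma measure_entropy_le_of_induced_pressure_less:
  assumes cpt: "compact (UNIV :: 'a set)" and \<phi>: "continuous_on UNIV \<phi>" and \<psi>: "continuous_on UNIV \<psi>"
    and pos: "\<forall>x. \<psi> x > 0" and s: "induced_pressure f \<psi> \<phi> < ereal s"
  shows "measure_entropy f \<mu> \<le> ereal (s * (\<integral>x. \<psi> x \<partial>\<mu>) - (\<integral>x. \<phi> x \<partial>\<mu>))"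
proof (rule measure_entropy_leI)
  fix \<xi> :: "'a set set" and \<eta> :: real assume \<xi>: "finite \<xi>" "\<xi> \<subseteq> sets \<mu>" "partition_on UNIV \<xi>" and \<eta>: "\<eta> > 0"
  let ?b = "s * (\<integral>x. \<psi> x \<partial>\<mu>) - (\<integral>x. \<phi> x \<partial>\<mu>)"
  have \<eta>3: "\<eta> / 3 > 0" using \<eta> by simp
  obtain r and Z :: "'a \<Rightarrow> 'a set option" where "r > 0"
    and Z: "simple_function \<mu> Z" "label_entropy \<mu> Z \<le> \<eta> / 3"
      "\<And>x y. Z x = Z y \<Longrightarrow> dist x y < r \<Longrightarrow> cell \<xi> x = cell \<xi> y"
    using partition_coding_at_small_scale[OF cpt \<xi> \<eta>3] by metis
  have "uniformly_continuous_on UNIV \<phi>" using compact_uniformly_continuous[OF \<phi> cpt] .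
  then obtain d where d: "d > 0" "\<And>x y. dist x y < d \<Longrightarrow> \<bar>\<phi> x - \<phi> y\<bar> < \<eta> / 3"
    using \<eta>3 unfolding uniformly_continuous_on_def dist_real_def by (metis UNIV_I)
  define \<epsilon> where "\<epsilon> = min (r / 3) (d / 2)"
  have \<epsilon>: "\<epsilon> > 0" "2 * \<epsilon> < r" "\<epsilon> < d" using \<open>r > 0\<close> d(1) by (auto simp: \<epsilon>_def min_def)
  obtain T0 where T0: "T0 > 0" "\<And>T. T \<ge> T0 \<Longrightarrow> induced_Q f \<psi> \<phi> T \<epsilon> < ennreal (exp (s * T))"
  proof -
    have "Limsup at_top (\<lambda>T. ereal (1 / T) * ln_ennreal (induced_Q f \<psi> \<phi> T \<epsilon>)) < ereal s"
      using Limsup_induced_Q_le[OF \<epsilon>(1)] s by (rule le_less_trans)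
    from Limsup_lessD[OF this] eventually_gt_at_top[of 0]
    have "\<forall>\<^sub>F T in at_top. induced_Q f \<psi> \<phi> T \<epsilon> < ennreal (exp (s * T))"
      by eventually_elim (rule less_exp_if_ln_ennreal_less)
    then obtain T1 where "\<And>T. T \<ge> T1 \<Longrightarrow> induced_Q f \<psi> \<phi> T \<epsilon> < ennreal (exp (s * T))"
      by (auto simp: eventually_at_top_linorder)
    then show ?thesis by (intro that[of "max 1 T1"]) auto
  qed
  obtain x0 where x0: "\<And>x. \<psi> x0 \<le> \<psi> x"
    using continuous_attains_inf[OF cpt _ \<psi>] by auto
  define m where "m = \<psi> x0"
  have m: "m > 0" "\<And>x. m \<le> \<psi> x" using pos x0 by (auto simp: m_def)
  obtain x1 where x1: "\<And>x. \<psi> x \<le> \<psi> x1"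
    using continuous_attains_sup[OF cpt _ \<psi>] by auto
  define M where "M = \<psi> x1"
  have M: "M > 0" "\<And>x. \<psi> x \<le> M" using pos x1 by (auto simp: M_def)
  have Suc_psi: "birkhoff_sum f \<psi> (n + 1) x = birkhoff_sum f \<psi> n x + \<psi> ((f ^^ n) x)" for n x
    by (simp add: birkhoff_sum_def)
  have psi_lower: "real n * m \<le> birkhoff_sum f \<psi> n x" and psi_upper: "birkhoff_sum f \<psi> n x \<le> real n * M" for n x
    unfolding birkhoff_sum_def
    using sum_mono[of "{..<n}" "\<lambda>_. m" "\<lambda>i. \<psi> ((f ^^ i) x)"] m(2)
      sum_mono[of "{..<n}" "\<lambda>i. \<psi> ((f ^^ i) x)" "\<lambda>_. M"] M(2) by auto
  \<comment> \<open>At most \<open>c * n\<close> multiples of \<open>m\<close> occur as levels at time \<open>n\<close>.\<close>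
  define c where "c = 2 * M / m + 1"
  have c: "c > 0" using m M by (simp add: c_def add_pos_pos)
  have main: "label_entropy \<mu> (orbit_name (cell \<xi>) n) - real n * ?b
      \<le> real n * (\<eta> / 3) + (ln (c * real n) + real n * (\<eta> / 3) + \<bar>s\<bar> * M)"
    if n: "n \<ge> 1" and large: "T0 \<le> real n * m" for n
  proof -
    have contS: "continuous_on UNIV (birkhoff_sum f \<phi> n)" "continuous_on UNIV (birkhoff_sum f \<psi> k)" for k
      by (rule continuous_on_birkhoff_sum[OF continuous_f] \<phi> \<psi>)+
    obtain y where "\<And>x. birkhoff_sum f \<phi> n y \<le> birkhoff_sum f \<phi> n x"
      using continuous_attains_inf[OF cpt _ contS(1)] by auto
    then have K: "- (- birkhoff_sum f \<phi> n y) \<le> birkhoff_sum f \<phi> n x" for x by simp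
    define t where "t j = real j * m" for j :: nat
    define J where "J = {j. real j \<le> real (n + 1) * M / m \<and> T0 \<le> t j \<and> n \<in> level_times f \<psi> (t j)}"
    have J_sub: "J \<subseteq> {..nat \<lfloor>real (n + 1) * M / m\<rfloor>}"
      by (auto simp: J_def le_nat_floor)
    then have finJ: "finite J" by (rule finite_subset) simp
    have "real (card J) \<le> c * real n"
    proof -
      have "real (card J) \<le> real (nat \<lfloor>real (n + 1) * M / m\<rfloor>) + 1"
        using card_mono[OF _ J_sub] by simp
      also have "\<dots> \<le> real (n + 1) * M / m + 1"
        using m M by (simp add: of_nat_floor)
      also have "\<dots> \<le> 2 * real n * M / m + real n"
        using n m M by (intro add_mono divide_right_mono mult_right_mono) auto
      finally show ?thesis by (simp add: c_def field_simps)
    qed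
    have "\<exists>F. finite F \<and> spanning_set f n \<epsilon> (level_set f \<psi> (t j) n) F \<and>
        (\<Sum>x\<in>F. exp (birkhoff_sum f \<phi> n x)) \<le> exp (s * t j)" if "j \<in> J" for j
      by (rule spanning_family_exists[OF T0(2) K]) (use that in \<open>auto simp: J_def\<close>)
    then obtain F where F: "\<And>j. j \<in> J \<Longrightarrow> finite (F j)"
      "\<And>j. j \<in> J \<Longrightarrow> spanning_set f n \<epsilon> (level_set f \<psi> (t j) n) (F j)"
      "\<And>j. j \<in> J \<Longrightarrow> (\<Sum>x\<in>F j. exp (birkhoff_sum f \<phi> n x)) \<le> exp (s * t j)" by metis
    \<comment> \<open>The cover is indexed by pairs of a level and an element of the spanning set for that level.\<close>
    define L where "L = Sigma J F"
    define C where "C = (\<lambda>(j, e). level_set f \<psi> (t j) n \<inter> {y. bowen_dist f n e y \<le> \<epsilon>})"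
    define a where "a = (\<lambda>(j, e). birkhoff_sum f \<phi> n e - s * t j + (real n * (\<eta> / 3) + \<bar>s\<bar> * M))"
    define g where "g x = birkhoff_sum f \<phi> n x - s * birkhoff_sum f \<psi> n x" for x
    have finL: "finite L" unfolding L_def using finJ F(1) by (rule finite_SigmaI)
    have cover: "(\<Union>l\<in>L. C l) = UNIV"
    proof (rule UNIV_eq_I[symmetric])
      fix x
      \<comment> \<open>The least multiple of \<open>m\<close> not below \<open>S\<^sub>n\<psi>(x)\<close> is below \<open>S\<^sub>n\<^sub>+\<^sub>1\<psi>(x)\<close>, because \<open>\<psi> \<ge> m\<close>.\<close>
      define j where "j = nat \<lceil>birkhoff_sum f \<psi> n x / m\<rceil>"
      have "0 \<le> real n * m" using m by simp
      then have "0 \<le> birkhoff_sum f \<psi> n x" using psi_lower[of n x] by linarith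
      then have S0: "0 \<le> birkhoff_sum f \<psi> n x / m" using m by simp
      have "birkhoff_sum f \<psi> n x / m \<le> real j" "real j < birkhoff_sum f \<psi> n x / m + 1"
        using S0 unfolding j_def by (auto simp: of_nat_ceiling) linarith
      then have j: "birkhoff_sum f \<psi> n x \<le> t j" "t j < birkhoff_sum f \<psi> n x + m"
        using m by (auto simp: t_def field_simps)
      have lev: "x \<in> level_set f \<psi> (t j) n"
        using j m(2)[of "(f ^^ n) x"] unfolding level_set_def Suc_psi by auto
      moreover have "real j \<le> real (n + 1) * M / m"
        using lev psi_upper[of "n + 1" x] m unfolding level_set_def t_def by (simp add: field_simps)
      moreover have "T0 \<le> t j" using large psi_lower[of n x] j(1) by linarith
      ultimately have "j \<in> J" using n unfolding J_def level_times_def level_set_def by blast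
      moreover obtain e where "e \<in> F j" "bowen_dist f n e x \<le> \<epsilon>"
        using F(2)[OF \<open>j \<in> J\<close>] lev unfolding spanning_set_def by blast
      ultimately show "x \<in> (\<Union>l\<in>L. C l)"
        unfolding L_def C_def using lev by (intro UN_I[of "(j, e)"]) auto
    qed
    have "label_entropy \<mu> (orbit_name (cell \<xi>) n) + (\<integral>x. g x \<partial>\<mu>) \<le> real n * (\<eta> / 3) + ln (\<Sum>l\<in>L. exp (a l))"
    proof (rule entropy_le_cover_sum[OF Z finL _ cover])
      fix l assume "l \<in> L"
      have "level_set f \<psi> T n \<in> sets borel" for T
        unfolding level_set_def Collect_conj_eq
        by (intro sets.Int borel_closed borel_open closed_Collect_le open_Collect_less
            contS continuous_on_const)
      moreover have "{y. bowen_dist f n e y \<le> \<epsilon>} \<in> sets borel" for e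
        by (intro borel_closed closed_bowen_ball continuous_f n)
      ultimately show "C l \<in> sets \<mu>"
        unfolding C_def sets_eq by (cases l) simp
    next
      fix l x y i assume "l \<in> L" and xy: "x \<in> C l" "y \<in> C l" and i: "i < n"
      obtain j e where l: "l = (j, e)" by (cases l)
      have "dist ((f ^^ i) e) ((f ^^ i) x) \<le> \<epsilon>" "dist ((f ^^ i) e) ((f ^^ i) y) \<le> \<epsilon>"
        using xy i unfolding l C_def by (auto simp: bowen_dist_le_iff[OF n])
      then show "dist ((f ^^ i) x) ((f ^^ i) y) < r"
        using \<epsilon>(2) dist_triangle3[of "(f ^^ i) x" "(f ^^ i) y" "(f ^^ i) e"] by linarith
    next
      show "integrable \<mu> g"
        unfolding g_def by (rule integrable_continuous[OF cpt]) (intro continuous_intros contS)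
    next
      fix l x assume "l \<in> L" and x: "x \<in> C l"
      obtain j e where l: "l = (j, e)" by (cases l)
      have "\<bar>\<phi> ((f ^^ i) x) - \<phi> ((f ^^ i) e)\<bar> < \<eta> / 3" if "i < n" for i
      proof (rule d(2))
        have "dist ((f ^^ i) e) ((f ^^ i) x) \<le> \<epsilon>"
          using x that unfolding l C_def by (auto simp: bowen_dist_le_iff[OF n])
        then show "dist ((f ^^ i) x) ((f ^^ i) e) < d" using \<epsilon>(3) by (simp add: dist_commute)
      qed
      then have "(\<Sum>i<n. \<phi> ((f ^^ i) x)) \<le> (\<Sum>i<n. \<phi> ((f ^^ i) e) + \<eta> / 3)"
        by (intro sum_mono) (smt (verit) lessThan_iff)
      then have 1: "birkhoff_sum f \<phi> n x \<le> birkhoff_sum f \<phi> n e + real n * (\<eta> / 3)"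
        by (simp add: birkhoff_sum_def sum.distrib)
      have "0 \<le> t j - birkhoff_sum f \<psi> n x" "t j - birkhoff_sum f \<psi> n x \<le> M"
        using x M(2)[of "(f ^^ n) x"] unfolding l C_def level_set_def Suc_psi by auto
      then have "s * (t j - birkhoff_sum f \<psi> n x) \<le> \<bar>s\<bar> * M"
        by (intro mult_mono) auto
      then show "g x \<le> a l" using 1 unfolding g_def a_def l by (simp add: algebra_simps)
    qed
    moreover have "(\<integral>x. g x \<partial>\<mu>) = - (real n * ?b)"
      unfolding g_def using contS
      by (subst Bochner_Integration.integral_diff)
        (auto simp: integral_birkhoff_sum[OF cpt] \<phi> \<psi> algebra_simps intro!: integrable_continuous[OF cpt])
    moreover have "ln (\<Sum>l\<in>L. exp (a l)) \<le> ln (c * real n) + real n * (\<eta> / 3) + \<bar>s\<bar> * M"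
    proof -
      let ?k = "real n * (\<eta> / 3) + \<bar>s\<bar> * M"
      have weight: "exp (a (j, e)) = exp (?k - s * t j) * exp (birkhoff_sum f \<phi> n e)" for j e
        unfolding exp_add[symmetric] by (simp add: a_def)
      have "(\<Sum>l\<in>L. exp (a l)) = (\<Sum>j\<in>J. \<Sum>e\<in>F j. exp (a (j, e)))"
        unfolding L_def using finJ F(1) by (subst sum.Sigma) auto
      also have "\<dots> = (\<Sum>j\<in>J. exp (?k - s * t j) * (\<Sum>e\<in>F j. exp (birkhoff_sum f \<phi> n e)))"
        unfolding weight sum_distrib_left ..
      also have "\<dots> \<le> (\<Sum>j\<in>J. exp (?k - s * t j) * exp (s * t j))"
        using F(3) by (intro sum_mono mult_left_mono) auto
      also have "\<dots> = real (card J) * exp ?k" by (simp add: exp_add[symmetric])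
      also have "\<dots> \<le> c * real n * exp ?k"
        using \<open>real (card J) \<le> c * real n\<close> by (rule mult_right_mono) simp
      finally have le: "(\<Sum>l\<in>L. exp (a l)) \<le> c * real n * exp ?k" .
      have "L \<noteq> {}" using cover by auto
      then have "0 < (\<Sum>l\<in>L. exp (a l))" using finL by (intro sum_pos) auto
      with le have "ln (\<Sum>l\<in>L. exp (a l)) \<le> ln (c * real n * exp ?k)" by (simp del: times_divide_eq_right)
      also have "\<dots> = ln (c * real n) + ?k" using c n by (subst ln_mult) auto
      finally show ?thesis by simp
    qed
    ultimately show ?thesis by linarith
  qed
  obtain n0 :: nat where n0: "T0 / m \<le> real n0" using real_arch_simple by blast
  have "\<forall>\<^sub>F n in sequentially. ln (c * real n) + \<bar>s\<bar> * M \<le> real n * (\<eta> / 3)"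
    by (rule eventually_ln_linear_le[OF c \<eta>3])
  then show "\<forall>\<^sub>F n in sequentially. label_entropy \<mu> (orbit_name (cell \<xi>) n) \<le> real n * (?b + \<eta>)"
    using eventually_ge_at_top[of "max 1 n0"]
  proof eventually_elim
    fix n :: nat assume *: "ln (c * real n) + \<bar>s\<bar> * M \<le> real n * (\<eta> / 3)" and n: "max 1 n0 \<le> n"
    have "T0 / m \<le> real n" using n0 n by linarith
    then have "T0 \<le> real n * m" using m by (simp add: field_simps)
    then have "label_entropy \<mu> (orbit_name (cell \<xi>) n) \<le> real n * ?b + (real n * (\<eta> / 3) + real n * (\<eta> / 3) + real n * (\<eta> / 3))"
      using main[of n] n * by linarith
    then show "label_entropy \<mu> (orbit_name (cell \<xi>) n) \<le> real n * (?b + \<eta>)"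
      by (simp add: algebra_simps)
  qed
qed

end

section \<open>Freezing\<close>

theorem theorem3p4:
  fixes f :: "'a::metric_space \<Rightarrow> 'a"
    and \<phi> \<psi> :: "'a \<Rightarrow> real"
    and \<beta>\<^sub>0 :: real
  assumes "compact (UNIV :: 'a set)"
    and "continuous_on UNIV f"
    and "topological_entropy f < \<infinity>"
    and "continuous_on UNIV \<phi>"
    and "continuous_on UNIV \<psi>"
    and "\<forall>x. \<psi> x > 0"
  shows "freezes_at f \<psi> \<phi> \<beta>\<^sub>0 \<longleftrightarrow>
    (\<forall>\<beta>\<ge>\<beta>\<^sub>0. induced_pressure f \<psi> (\<lambda>x. \<beta> * \<phi> x)
                = ereal (\<beta> * Max_ratio f \<psi> \<phi>) + h_infinity f \<psi> \<phi>) \<and>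
    (\<exists>\<beta>\<^sub>1>\<beta>\<^sub>0. \<exists>\<mu>. equilibrium_state f \<psi> (\<lambda>x. \<beta>\<^sub>1 * \<phi> x) \<mu>)"
proof -
  note cpt = assms(1) and \<phi> = assms(4) and \<psi> = assms(5) and pos = assms(6)
  let ?I = "invariant_measures f" and ?P = "\<lambda>\<beta>. induced_pressure f \<psi> (\<lambda>x. \<beta> * \<phi> x)"
  have sys: "invariant_probability \<nu> f" if "\<nu> \<in> ?I" for \<nu>
    using that assms(2)
    by (auto simp: invariant_measures_def invariant_probability_def invariant_probability_axioms_def
        information_space_def information_space_axioms_def)
  define \<Psi> \<Phi> H where "\<Psi> \<nu> = (\<integral>x. \<psi> x \<partial>\<nu>)" and "\<Phi> \<nu> = (\<integral>x. \<phi> x \<partial>\<nu>)"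
    and "H \<nu> = real_of_ereal (measure_entropy f \<nu>)" for \<nu>
  define a h where "a \<nu> = \<Phi> \<nu> / \<Psi> \<nu>" and "h \<nu> = H \<nu> / \<Psi> \<nu>" for \<nu>
  obtain x0 where x0: "\<And>x. \<psi> x0 \<le> \<psi> x"
    using continuous_attains_inf[OF cpt _ \<psi>] by auto
  obtain x1 where x1: "\<And>x. \<bar>\<phi> x\<bar> \<le> \<bar>\<phi> x1\<bar>"
    using continuous_attains_sup[OF cpt _ continuous_on_rabs[OF \<phi>]] by auto
  have \<Psi>_lower: "\<psi> x0 \<le> \<Psi> \<nu>" and \<Phi>_upper: "\<Phi> \<nu> \<le> \<bar>\<phi> x1\<bar>" if "\<nu> \<in> ?I" for \<nu>
  proof -
    interpret invariant_probability \<nu> f by (rule sys[OF that])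
    have "(\<integral>x. \<psi> x0 \<partial>\<nu>) \<le> \<Psi> \<nu>" unfolding \<Psi>_def
      using x0 by (intro integral_mono integrable_continuous[OF cpt] \<psi>) auto
    then show "\<psi> x0 \<le> \<Psi> \<nu>" by (simp add: prob_space)
    have "\<Phi> \<nu> \<le> (\<integral>x. \<bar>\<phi> x1\<bar> \<partial>\<nu>)" unfolding \<Phi>_def
      using x1 by (intro integral_mono integrable_continuous[OF cpt] \<phi>) (auto intro: order_trans[OF abs_ge_self])
    then show "\<Phi> \<nu> \<le> \<bar>\<phi> x1\<bar>" by (simp add: prob_space)
  qed
  have \<Psi>_pos: "\<Psi> \<nu> > 0" if "\<nu> \<in> ?I" for \<nu> using \<Psi>_lower[OF that] pos less_le_trans by blast
  have H: "measure_entropy f \<nu> = ereal (H \<nu>)" "0 \<le> H \<nu>" if "\<nu> \<in> ?I" for \<nu>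
  proof -
    interpret invariant_probability \<nu> f by (rule sys[OF that])
    show "measure_entropy f \<nu> = ereal (H \<nu>)" "0 \<le> H \<nu>"
      using measure_entropy_nonneg measure_entropy_finite[OF cpt assms(3)]
      unfolding H_def by (auto simp: ereal_real real_of_ereal_pos)
  qed
  have integral_scale: "(\<integral>x. \<beta> * \<phi> x \<partial>\<nu>) = \<beta> * \<Phi> \<nu>" for \<beta> \<nu>
    by (simp add: \<Phi>_def)
  have equilibrium_iff: "equilibrium_state f \<psi> (\<lambda>x. \<beta> * \<phi> x) \<nu> \<longleftrightarrow> \<nu> \<in> ?I \<and> ?P \<beta> = ereal (h \<nu> + \<beta> * a \<nu>)" for \<beta> \<nu>
  proof (cases "\<nu> \<in> ?I")
    case True
    have "(measure_entropy f \<nu> + ereal (\<integral>x. \<beta> * \<phi> x \<partial>\<nu>)) / ereal (\<integral>x. \<psi> x \<partial>\<nu>) = ereal (h \<nu> + \<beta> * a \<nu>)"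
      using \<Psi>_pos[OF True] unfolding H(1)[OF True] integral_scale \<Psi>_def[symmetric]
      by (simp add: h_def a_def add_divide_distrib)
    then show ?thesis by (simp add: equilibrium_state_def True)
  qed (simp add: equilibrium_state_def)
  have variational: "ereal (h \<nu> + \<beta> * a \<nu>) \<le> ?P \<beta>" if "\<nu> \<in> ?I" for \<nu> \<beta>
  proof (rule ccontr)
    assume "\<not> ereal (h \<nu> + \<beta> * a \<nu>) \<le> ?P \<beta>"
    then obtain s where s: "?P \<beta> < ereal s" "ereal s < ereal (h \<nu> + \<beta> * a \<nu>)"
      using ereal_dense2 by (metis not_le)
    interpret invariant_probability \<nu> f by (rule sys[OF that])
    have "measure_entropy f \<nu> \<le> ereal (s * \<Psi> \<nu> - \<beta> * \<Phi> \<nu>)"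
      using measure_entropy_le_of_induced_pressure_less[OF cpt continuous_on_mult_left[OF \<phi>] \<psi> pos s(1)]
      unfolding integral_scale \<Psi>_def by simp
    then have "H \<nu> \<le> s * \<Psi> \<nu> - \<beta> * \<Phi> \<nu>" by (simp add: H[OF that])
    then have "h \<nu> + \<beta> * a \<nu> \<le> s" using \<Psi>_pos[OF that] by (simp add: h_def a_def field_simps)
    with s(2) show False by simp
  qed
  have Max: "Max_ratio f \<psi> \<phi> = (SUP \<nu>\<in>?I. a \<nu>)"
    by (simp add: Max_ratio_def a_def \<Psi>_def \<Phi>_def)
  have maximizing: "maximizing_measures f \<psi> \<phi> = {\<nu> \<in> ?I. a \<nu> = Max_ratio f \<psi> \<phi>}"
    by (simp add: maximizing_measures_def a_def \<Psi>_def \<Phi>_def)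
  have h_inf: "h_infinity f \<psi> \<phi> = (SUP \<nu>\<in>maximizing_measures f \<psi> \<phi>. ereal (h \<nu>))"
    unfolding h_infinity_def
    by (rule SUP_cong) (auto simp: maximizing H h_def \<Psi>_def[symmetric] dest: \<Psi>_pos)
  show ?thesis
  proof
    assume "freezes_at f \<psi> \<phi> \<beta>\<^sub>0"
    then obtain \<mu> where \<mu>: "\<mu> \<in> ?I" and eq: "\<And>\<beta>. \<beta> \<ge> \<beta>\<^sub>0 \<Longrightarrow> equilibrium_state f \<psi> (\<lambda>x. \<beta> * \<phi> x) \<mu>"
      by (auto simp: freezes_at_def)
    then have P: "?P \<beta> = ereal (h \<mu> + \<beta> * a \<mu>)" if "\<beta> \<ge> \<beta>\<^sub>0" for \<beta>
      using that equilibrium_iff by blast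
    then have le: "h \<nu> + \<beta> * a \<nu> \<le> h \<mu> + \<beta> * a \<mu>" if "\<nu> \<in> ?I" "\<beta> \<ge> \<beta>\<^sub>0" for \<nu> \<beta>
      using variational[OF that(1), of \<beta>] that(2) by simp
    have a_le: "a \<nu> \<le> a \<mu>" if "\<nu> \<in> ?I" for \<nu>
    proof (rule ccontr)
      assume "\<not> a \<nu> \<le> a \<mu>"
      then have pos: "a \<nu> - a \<mu> > 0" by simp
      \<comment> \<open>Beyond this parameter the larger slope \<open>a \<nu>\<close> outweighs any advantage of \<open>h \<mu>\<close>.\<close>
      define \<beta> where "\<beta> = max \<beta>\<^sub>0 ((h \<mu> - h \<nu>) / (a \<nu> - a \<mu>) + 1)"
      have "\<beta> * (a \<nu> - a \<mu>) \<ge> ((h \<mu> - h \<nu>) / (a \<nu> - a \<mu>) + 1) * (a \<nu> - a \<mu>)"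
        using pos by (intro mult_right_mono) (auto simp: \<beta>_def)
      also have "((h \<mu> - h \<nu>) / (a \<nu> - a \<mu>) + 1) * (a \<nu> - a \<mu>) = h \<mu> - h \<nu> + (a \<nu> - a \<mu>)"
        using pos by (simp add: distrib_right)
      finally have "\<beta> * (a \<nu> - a \<mu>) > h \<mu> - h \<nu>" using pos by linarith
      moreover have "h \<nu> + \<beta> * a \<nu> \<le> h \<mu> + \<beta> * a \<mu>" by (rule le[OF that]) (simp add: \<beta>_def)
      ultimately show False by (simp add: algebra_simps)
    qed
    have max: "Max_ratio f \<psi> \<phi> = a \<mu>"
      unfolding Max using \<mu> a_le by (intro cSup_eq_maximum) auto
    have "h \<nu> \<le> h \<mu>" if "\<nu> \<in> maximizing_measures f \<psi> \<phi>" for \<nu>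
      using le[of \<nu> \<beta>\<^sub>0] that unfolding maximizing max by simp
    then have "h_infinity f \<psi> \<phi> = ereal (h \<mu>)"
      unfolding h_inf using \<mu> max by (intro SUP_eqI) (auto simp: maximizing)
    then show "(\<forall>\<beta>\<ge>\<beta>\<^sub>0. ?P \<beta> = ereal (\<beta> * Max_ratio f \<psi> \<phi>) + h_infinity f \<psi> \<phi>) \<and>
        (\<exists>\<beta>\<^sub>1>\<beta>\<^sub>0. \<exists>\<mu>. equilibrium_state f \<psi> (\<lambda>x. \<beta>\<^sub>1 * \<phi> x) \<mu>)"
      using P eq[of "\<beta>\<^sub>0 + 1"] by (auto simp: max add.commute intro!: exI[of _ "\<beta>\<^sub>0 + 1"])
  next
    assume R: "(\<forall>\<beta>\<ge>\<beta>\<^sub>0. ?P \<beta> = ereal (\<beta> * Max_ratio f \<psi> \<phi>) + h_infinity f \<psi> \<phi>) \<and>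
        (\<exists>\<beta>\<^sub>1>\<beta>\<^sub>0. \<exists>\<mu>. equilibrium_state f \<psi> (\<lambda>x. \<beta>\<^sub>1 * \<phi> x) \<mu>)"
    then obtain \<beta>\<^sub>1 \<mu> where \<beta>\<^sub>1: "\<beta>\<^sub>1 > \<beta>\<^sub>0" and \<mu>: "\<mu> \<in> ?I" and P1: "?P \<beta>\<^sub>1 = ereal (h \<mu> + \<beta>\<^sub>1 * a \<mu>)"
      using equilibrium_iff by blast
    let ?m = "Max_ratio f \<psi> \<phi>"
    have P: "?P \<beta> = ereal (\<beta> * ?m) + h_infinity f \<psi> \<phi>" if "\<beta> \<ge> \<beta>\<^sub>0" for \<beta> using R that by blast
    have "ereal (h \<mu> + \<beta>\<^sub>1 * a \<mu>) = ereal (\<beta>\<^sub>1 * ?m) + h_infinity f \<psi> \<phi>" using P[of \<beta>\<^sub>1] P1 \<beta>\<^sub>1 by simp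
    \<comment> \<open>The left-hand side is real, so \<open>h_infinity\<close> is real and some maximizing measure exists.\<close>
    then obtain k where k: "h_infinity f \<psi> \<phi> = ereal k" "h \<mu> + \<beta>\<^sub>1 * a \<mu> = \<beta>\<^sub>1 * ?m + k"
      by (cases "h_infinity f \<psi> \<phi>") auto
    have "bdd_above (a ` ?I)"
    proof (rule bdd_aboveI2)
      fix \<nu> assume \<nu>: "\<nu> \<in> ?I"
      have "\<Phi> \<nu> / \<Psi> \<nu> \<le> \<bar>\<phi> x1\<bar> / \<psi> x0"
        using \<Phi>_upper[OF \<nu>] \<Psi>_lower[OF \<nu>] pos by (intro frac_le) auto
      then show "a \<nu> \<le> \<bar>\<phi> x1\<bar> / \<psi> x0" by (simp add: a_def)
    qed
    then have up: "a \<mu> \<le> ?m" unfolding Max using \<mu> by (rule cSUP_upper[rotated])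
    have "h \<mu> + \<beta>\<^sub>0 * a \<mu> \<le> \<beta>\<^sub>0 * ?m + k" using variational[OF \<mu>, of \<beta>\<^sub>0] P[of \<beta>\<^sub>0] k(1) by simp
    then have "(\<beta>\<^sub>1 - \<beta>\<^sub>0) * ?m \<le> (\<beta>\<^sub>1 - \<beta>\<^sub>0) * a \<mu>" using k(2) by (simp add: algebra_simps)
    then have "?m \<le> a \<mu>" using \<beta>\<^sub>1 by simp
    with up have "a \<mu> = ?m" by simp
    then have "?P \<beta> = ereal (h \<mu> + \<beta> * a \<mu>)" if "\<beta> \<ge> \<beta>\<^sub>0" for \<beta>
      using P[OF that] k by simp
    then show "freezes_at f \<psi> \<phi> \<beta>\<^sub>0"
      unfolding freezes_at_def equilibrium_iff using \<mu> by blast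
  qed
qed

end
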